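(* Let $G$ be a discrete countable group and let $\mu$ be an admissible probability measure on $G$. Let $(X,d)$ be a separable complete $\mathrm{CAT}(0)$ space and let $G\curvearrowright (X,d)$ be an action by isometries such that $G$ contains two independent contracting elements. Let $o\in X$ be a basepoint. Then the random walk $(Z_n o)_n$ converges almost surely to a point of the visual boundary $\partial_\infty X$ of $X$.
   Context: $\mu$ is admissible if its support generates $G$ as a semigroup. Let $\Omega=G^{\mathbb N}$, $\mathbb P=\mu^{\otimes\mathbb N}$; for $\omega=(\omega_i)\in\Omega$ the random walk generated by $\mu$ is $Z_n(\omega)=\omega_1\omega_2\cdots\omega_n$, $Z_0=\mathrm{id}$. "Almost surely" refers to $\mathbb P$. The visual boundary $\partial_\infty X$ is the set of equivalence classes of geodesic rays at finite Hausdorff distance; $\overline X=X\cup\partial_\infty X$ carries the cone topology (uniform convergence on compact sets of geodesic segments/rays issued from a fixed basepoint). An isometry $g$ of $X$ is axial if its displacement function $x\mapsto d(gx,x)$ attains a positive minimum; equivalently $g$ translates nontrivially along some geodesic line (an axis). A geodesic $\gamma$ is $C$-contracting ($C>0$) if for every metric ball $B$ disjoint from $\gamma$, the nearest-point projection $\pi_\gamma(B)$ has diameter at most $C$. An axial isometry is contracting if one of its axes is $C$-contracting for some $C>0$. Two axial isometries $g_1,g_2$ are independent if the map $(m,n)\in\mathbb Z\times\mathbb Z\mapsto d(g_1^m o,g_2^n o)\in[0,\infty)$ is proper; for contracting isometries this amounts to their pairs of fixed points in $\partial_\infty X$ being disjoint. *)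

theory Defs
  imports "HOL-Probability.Probability" "HOL-Algebra.Group_Action"
begin

section \<open>Geodesics and CAT(0) spaces\<close>

definition isometric_embedding_on :: "real set \<Rightarrow> (real \<Rightarrow> 'x::metric_space) \<Rightarrow> bool" where
  "isometric_embedding_on S \<gamma> \<longleftrightarrow> (\<forall>s\<in>S. \<forall>t\<in>S. dist (\<gamma> s) (\<gamma> t) = \<bar>s - t\<bar>)"

definition geodesic_segment :: "(real \<Rightarrow> 'x::metric_space) \<Rightarrow> 'x \<Rightarrow> 'x \<Rightarrow> bool" where
  "geodesic_segment \<gamma> x y \<longleftrightarrow>
     isometric_embedding_on {0..dist x y} \<gamma> \<and> \<gamma> 0 = x \<and> \<gamma> (dist x y) = y"

definition geodesic_ray :: "(real \<Rightarrow> 'x::metric_space) \<Rightarrow> bool" where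
  "geodesic_ray \<gamma> \<longleftrightarrow> isometric_embedding_on {0..} \<gamma>"

definition geodesic_line :: "(real \<Rightarrow> 'x::metric_space) \<Rightarrow> bool" where
  "geodesic_line \<gamma> \<longleftrightarrow> isometric_embedding_on UNIV \<gamma>"

text \<open>
  Comparison with Euclidean triangles. Any two distinct sides of a geodesic triangle share a
  vertex, here \<open>p\<close>, so it suffices to compare the sides \<open>[p,q]\<close> and \<open>[p,r]\<close> for all labellings
  of the vertices; \<open>x'\<close> and \<open>y'\<close> are the comparison points of \<open>\<alpha> s\<close> and \<open>\<beta> t\<close>.
\<close>

definition CAT0_space :: "'x::metric_space itself \<Rightarrow> bool" where
  "CAT0_space (T :: 'x itself) \<longleftrightarrow>
     (\<forall>x y :: 'x. \<exists>\<gamma>. geodesic_segment \<gamma> x y) \<and>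
     (\<forall>(p :: 'x) q r \<alpha> \<beta>. geodesic_segment \<alpha> p q \<longrightarrow> geodesic_segment \<beta> p r \<longrightarrow>
       (\<forall>p' q' r' :: real^2.
          dist p' q' = dist p q \<longrightarrow> dist p' r' = dist p r \<longrightarrow> dist q' r' = dist q r \<longrightarrow>
          (\<forall>s\<in>{0..dist p q}. \<forall>t\<in>{0..dist p r}.
           \<forall>x'\<in>closed_segment p' q'. \<forall>y'\<in>closed_segment p' r'.
             dist p' x' = s \<longrightarrow> dist p' y' = t \<longrightarrow> dist (\<alpha> s) (\<beta> t) \<le> dist x' y')))"

section \<open>Visual boundary and cone topology\<close>

definition finite_Hausdorff_distance :: "'x::metric_space set \<Rightarrow> 'x set \<Rightarrow> bool" where
  "finite_Hausdorff_distance A B \<longleftrightarrow>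
     (\<exists>K. (\<forall>a\<in>A. \<exists>b\<in>B. dist a b \<le> K) \<and> (\<forall>b\<in>B. \<exists>a\<in>A. dist a b \<le> K))"

definition asymptotic :: "((real \<Rightarrow> 'x::metric_space) \<times> (real \<Rightarrow> 'x)) set" where
  "asymptotic = {(\<gamma>, \<gamma>'). geodesic_ray \<gamma> \<and> geodesic_ray \<gamma>' \<and>
                  finite_Hausdorff_distance (\<gamma> ` {0..}) (\<gamma>' ` {0..})}"

lemma finite_Hausdorff_distance_trans:
  assumes "finite_Hausdorff_distance A B" "finite_Hausdorff_distance B C"
  shows "finite_Hausdorff_distance A C"
proof -
  obtain K where K: "\<forall>a\<in>A. \<exists>b\<in>B. dist a b \<le> K" "\<forall>b\<in>B. \<exists>a\<in>A. dist a b \<le> K"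
    using assms(1) unfolding finite_Hausdorff_distance_def by blast
  obtain L where L: "\<forall>b\<in>B. \<exists>c\<in>C. dist b c \<le> L" "\<forall>c\<in>C. \<exists>b\<in>B. dist b c \<le> L"
    using assms(2) unfolding finite_Hausdorff_distance_def by blast
  have *: "dist a c \<le> K + L" if "dist a b \<le> K" "dist b c \<le> L" for a b c :: 'a
    using that dist_triangle[of a c b] by linarith
  have "\<forall>a\<in>A. \<exists>c\<in>C. dist a c \<le> K + L" using K(1) L(1) * by meson
  moreover have "\<forall>c\<in>C. \<exists>a\<in>A. dist a c \<le> K + L" using K(2) L(2) * by meson
  ultimately show ?thesis unfolding finite_Hausdorff_distance_def by blast
qed

lemma equiv_asymptotic: "equiv (Collect geodesic_ray) asymptotic"
proof (rule equivI)
  show "asymptotic \<subseteq> Collect geodesic_ray \<times> Collect geodesic_ray"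
    by (auto simp: asymptotic_def)
  have "finite_Hausdorff_distance A A" for A :: "'b::metric_space set"
    unfolding finite_Hausdorff_distance_def by (rule exI[of _ 0]) force
  then show "refl_on (Collect geodesic_ray) (asymptotic :: ((real \<Rightarrow> 'b::metric_space) \<times> _) set)"
    by (auto simp: refl_on_def asymptotic_def)
  show "sym asymptotic"
    by (rule symI) (auto simp: asymptotic_def finite_Hausdorff_distance_def dist_commute)
  show "trans asymptotic"
    by (rule transI) (auto simp: asymptotic_def intro: finite_Hausdorff_distance_trans)
qed

definition visual_boundary :: "(real \<Rightarrow> 'x::metric_space) set set" where
  "visual_boundary = Collect geodesic_ray // asymptotic"

datatype 'x bord = Interior 'x | Ideal "(real \<Rightarrow> 'x) set"

definition bordification :: "'x::metric_space bord set" where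
  "bordification = range Interior \<union> Ideal ` visual_boundary"

text \<open>
  \<open>geodesic_from b z c\<close>: on \<open>[0,\<infinity>)\<close>, \<open>c\<close> is the geodesic segment from \<open>b\<close> to \<open>z\<close>, continued
  constantly beyond its endpoint, if \<open>z\<close> is a point of the space, and a geodesic ray from \<open>b\<close> in
  the class \<open>z\<close> if \<open>z\<close> is a boundary point. In a complete CAT(0) space such \<open>c\<close> exists and is
  unique on \<open>[0,\<infinity>)\<close>.
\<close>

fun geodesic_from :: "'x::metric_space \<Rightarrow> 'x bord \<Rightarrow> (real \<Rightarrow> 'x) \<Rightarrow> bool" where
  "geodesic_from b (Interior x) c \<longleftrightarrow> geodesic_segment c b x \<and> (\<forall>t\<ge>dist b x. c t = x)"
| "geodesic_from b (Ideal \<xi>) c \<longleftrightarrow> geodesic_ray c \<and> c \<in> \<xi> \<and> c 0 = b"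

definition cone_nhd ::
    "'x::metric_space \<Rightarrow> (real \<Rightarrow> 'x) \<Rightarrow> real \<Rightarrow> real \<Rightarrow> 'x bord set" where
  "cone_nhd b c R \<epsilon> =
     {w \<in> bordification. \<forall>c'. geodesic_from b w c' \<longrightarrow> (\<forall>t\<in>{0..R}. dist (c t) (c' t) < \<epsilon>)}"

text \<open>The topology of uniform convergence on compact sets of the geodesics issued from \<open>b\<close>.\<close>

definition cone_open :: "'x::metric_space \<Rightarrow> 'x bord set \<Rightarrow> bool" where
  "cone_open b U \<longleftrightarrow> U \<subseteq> bordification \<and>
     (\<forall>z\<in>U. \<forall>c. geodesic_from b z c \<longrightarrow> (\<exists>R. \<exists>\<epsilon>>0. cone_nhd b c R \<epsilon> \<subseteq> U))"

definition cone_topology :: "'x::metric_space \<Rightarrow> 'x bord topology" where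
  "cone_topology b = topology (cone_open b)"

lemma cone_nhd_mono: "R \<le> R' \<Longrightarrow> \<epsilon>' \<le> \<epsilon> \<Longrightarrow> cone_nhd b c R' \<epsilon>' \<subseteq> cone_nhd b c R \<epsilon>"
proof
  fix w assume RR: "R \<le> R'" and ee: "\<epsilon>' \<le> \<epsilon>" and w: "w \<in> cone_nhd b c R' \<epsilon>'"
  have "dist (c t) (c' t) < \<epsilon>" if "geodesic_from b w c'" "t \<in> {0..R}" for c' t
  proof -
    have "t \<in> {0..R'}" using that RR by auto
    then have "dist (c t) (c' t) < \<epsilon>'" using w that(1) unfolding cone_nhd_def by blast
    then show ?thesis using ee by linarith
  qed
  then show "w \<in> cone_nhd b c R \<epsilon>" using w unfolding cone_nhd_def by blast
qed

lemma istopology_cone_open: "istopology (cone_open b)"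
  unfolding istopology_def
proof (intro conjI allI impI)
  fix U V assume U: "cone_open b U" and V: "cone_open b V"
  show "cone_open b (U \<inter> V)"
    unfolding cone_open_def
  proof (intro conjI ballI allI impI)
    show "U \<inter> V \<subseteq> bordification" using U by (auto simp: cone_open_def)
  next
    fix z c assume z: "z \<in> U \<inter> V" and c: "geodesic_from b z c"
    obtain R \<epsilon> where 1: "\<epsilon> > 0" "cone_nhd b c R \<epsilon> \<subseteq> U"
      using U z c unfolding cone_open_def by blast
    obtain R' \<epsilon>' where 2: "\<epsilon>' > 0" "cone_nhd b c R' \<epsilon>' \<subseteq> V"
      using V z c unfolding cone_open_def by blast
    have "cone_nhd b c (max R R') (min \<epsilon> \<epsilon>') \<subseteq> U \<inter> V"
      using 1 2 cone_nhd_mono[of R "max R R'" "min \<epsilon> \<epsilon>'" \<epsilon> b c]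
        cone_nhd_mono[of R' "max R R'" "min \<epsilon> \<epsilon>'" \<epsilon>' b c] by auto
    then show "\<exists>R. \<exists>\<epsilon>>0. cone_nhd b c R \<epsilon> \<subseteq> U \<inter> V"
      using 1 2 by (meson min_less_iff_conj)
  qed
next
  fix \<K> assume \<K>: "\<forall>K\<in>\<K>. cone_open b K"
  show "cone_open b (\<Union>\<K>)"
    unfolding cone_open_def
  proof (intro conjI ballI allI impI)
    show "\<Union>\<K> \<subseteq> bordification" using \<K> by (auto simp: cone_open_def)
  next
    fix z c assume "z \<in> \<Union>\<K>" and c: "geodesic_from b z c"
    then obtain K where K: "K \<in> \<K>" "z \<in> K" by blast
    then obtain R \<epsilon> where "\<epsilon> > 0" "cone_nhd b c R \<epsilon> \<subseteq> K"
      using \<K> c unfolding cone_open_def by blast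
    then show "\<exists>R. \<exists>\<epsilon>>0. cone_nhd b c R \<epsilon> \<subseteq> \<Union>\<K>" using K by blast
  qed
qed

lemma openin_cone_topology: "openin (cone_topology b) U \<longleftrightarrow> cone_open b U"
  by (simp add: cone_topology_def istopology_cone_open)

lemma topspace_cone_topology: "topspace (cone_topology b) = bordification"
proof -
  have "cone_open b bordification"
    unfolding cone_open_def cone_nhd_def by (auto intro: exI[of _ "1::real"])
  then show ?thesis
    unfolding topspace_def openin_cone_topology by (auto simp: cone_open_def)
qed

section \<open>Contracting isometries\<close>

definition axial :: "('x::metric_space \<Rightarrow> 'x) \<Rightarrow> bool" where
  "axial f \<longleftrightarrow> (\<exists>x. 0 < dist (f x) x \<and> (\<forall>y. dist (f x) x \<le> dist (f y) y))"

definition is_axis :: "('x::metric_space \<Rightarrow> 'x) \<Rightarrow> (real \<Rightarrow> 'x) \<Rightarrow> bool" where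
  "is_axis f \<gamma> \<longleftrightarrow> geodesic_line \<gamma> \<and> (\<exists>\<tau>. \<tau> \<noteq> 0 \<and> (\<forall>t. f (\<gamma> t) = \<gamma> (t + \<tau>)))"

definition nearest_points :: "'x::metric_space set \<Rightarrow> 'x \<Rightarrow> 'x set" where
  "nearest_points A x = {p \<in> A. \<forall>a\<in>A. dist x p \<le> dist x a}"

text \<open>
  Boundedness is required explicitly because \<open>diameter\<close> is only meaningful for bounded sets.
\<close>

definition contracting_line :: "real \<Rightarrow> (real \<Rightarrow> 'x::metric_space) \<Rightarrow> bool" where
  "contracting_line C \<gamma> \<longleftrightarrow>
     (\<forall>x r. ball x r \<inter> range \<gamma> = {} \<longrightarrow>
        bounded (\<Union>y\<in>ball x r. nearest_points (range \<gamma>) y) \<and>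
        diameter (\<Union>y\<in>ball x r. nearest_points (range \<gamma>) y) \<le> C)"

definition contracting_isometry :: "('x::metric_space \<Rightarrow> 'x) \<Rightarrow> bool" where
  "contracting_isometry f \<longleftrightarrow>
     axial f \<and> (\<exists>\<gamma> C. is_axis f \<gamma> \<and> C > 0 \<and> contracting_line C \<gamma>)"

definition independent_elements ::
    "('g, 'm) monoid_scheme \<Rightarrow> ('g \<Rightarrow> 'x::metric_space \<Rightarrow> 'x) \<Rightarrow> 'x \<Rightarrow> 'g \<Rightarrow> 'g \<Rightarrow> bool" where
  "independent_elements G \<phi> b g\<^sub>1 g\<^sub>2 \<longleftrightarrow>
     proper_map (discrete_topology (UNIV :: (int \<times> int) set)) (top_of_set {0::real..})
       (\<lambda>(m, n). dist (\<phi> (g\<^sub>1 [^]\<^bsub>G\<^esub> m) b) (\<phi> (g\<^sub>2 [^]\<^bsub>G\<^esub> n) b))"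

section \<open>Random walks\<close>

inductive_set semigroup_generated :: "('g, 'm) monoid_scheme \<Rightarrow> 'g set \<Rightarrow> 'g set"
  for G and S where
  incl: "g \<in> S \<Longrightarrow> g \<in> semigroup_generated G S"
| mult: "g \<in> semigroup_generated G S \<Longrightarrow> h \<in> semigroup_generated G S \<Longrightarrow>
           g \<otimes>\<^bsub>G\<^esub> h \<in> semigroup_generated G S"

definition admissible :: "('g, 'm) monoid_scheme \<Rightarrow> 'g pmf \<Rightarrow> bool" where
  "admissible G \<mu> \<longleftrightarrow> semigroup_generated G (set_pmf \<mu>) = carrier G"

definition path_measure :: "'g pmf \<Rightarrow> (nat \<Rightarrow> 'g) measure" where
  "path_measure \<mu> = PiM UNIV (\<lambda>_. measure_pmf \<mu>)"

text \<open>The increments are indexed from \<open>0\<close>, so that \<open>random_walk G \<omega> n = \<omega> 0 \<cdots> \<omega> (n - 1)\<close>.\<close>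

primrec random_walk :: "('g, 'm) monoid_scheme \<Rightarrow> (nat \<Rightarrow> 'g) \<Rightarrow> nat \<Rightarrow> 'g" where
  "random_walk G \<omega> 0 = \<one>\<^bsub>G\<^esub>"
| "random_walk G \<omega> (Suc n) = random_walk G \<omega> n \<otimes>\<^bsub>G\<^esub> \<omega> n"

end

(*
Every line eta contracting with constant C defines half-spaces {x. t_eta(x) >= s}, where t_eta is
the parameter of the projection to eta. A half-space far from the basepoint has small projection
to one of the two given axes, since otherwise both axes would run through its gate; hence it has
three disjoint translates by elements of a fixed finite set.

Let p_N(H) be the mean over n < N of P(Z_n b in H). It is stationary up to an error O(1/N), so
half-spaces H of almost maximal mass have translates of almost maximal mass, and the three disjoint
translates show that p_N(H) <= 2/5 for deep H and large N. For a fixed H the function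
h |-> p_N(h^-1 H) is therefore at most 2/5 far behind the gate of H and at least 3/5 far beyond it,
and it is almost harmonic: by optional stopping, the walk started deep inside a half-space stays
there forever with probability at least 1/3.

At every time m the basepoint b lies behind one of the two directions of the translate by Z_m of
the axis of g_1, and with conditional probability bounded below the walk ends up beyond that gate.
So this happens for infinitely many m almost surely; then all geodesics from b to Z_n b with n
large pass within bounded distance of Z_m b, these points go to infinity, and CAT(0) comparison
makes the geodesics converge to a ray.
*)

theory Submission
  imports Defs
begin

section \<open>Projections to lines\<close>

text \<open>The space need not be locally compact, so no stationary measure is extracted from a
  compactification. The averages p_N take its place, and each statement about them carries an error
  of order 1/N and a lower bound on N. All estimates are uniform over the class of all lines
  contracting with one constant \<open>C\<close>. This class is closed under isometries and under
  reversal: a supremum of masses over it is not raised by translation, and reversed lines bound the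
  complements of half-spaces. Three disjoint translates give a limiting supremum of at most 1/3. The
  bound used must lie strictly above 1/3 to hold at finite N, and below 1/2 to separate a deep
  half-space from one whose complement is deep. With 2/5 the two values are 2/5 and 3/5, and
  stopping yields (3/5 - 2/5) / (3/5) = 1/3. Projections are only coarsely defined, so each estimate
  loses a multiple of \<open>C\<close>; most later constants descend from the 8C and 14C in
  \<open>dist_ge_via_line\<close>.\<close>

definition nearest_param :: "(real \<Rightarrow> 'x::metric_space) \<Rightarrow> 'x \<Rightarrow> real \<Rightarrow> bool" where
  "nearest_param \<eta> x t \<longleftrightarrow> (\<forall>s. dist x (\<eta> t) \<le> dist x (\<eta> s))"

text \<open>The choice among several nearest parameters is harmless for a contracting line: by
  \<open>nearest_param_unique\<close> it matters by at most \<open>C\<close>.\<close>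

definition proj_param :: "(real \<Rightarrow> 'x::metric_space) \<Rightarrow> 'x \<Rightarrow> real" where
  "proj_param \<eta> x = (SOME t. nearest_param \<eta> x t)"

definition line_dist :: "(real \<Rightarrow> 'x::metric_space) \<Rightarrow> 'x \<Rightarrow> real" where
  "line_dist \<eta> x = dist x (\<eta> (proj_param \<eta> x))"

lemma geodesic_line_dist: "geodesic_line \<eta> \<Longrightarrow> dist (\<eta> s) (\<eta> t) = \<bar>s - t\<bar>"
  by (simp add: geodesic_line_def isometric_embedding_on_def)

lemma geodesic_line_continuous:
  assumes "geodesic_line \<eta>" shows "continuous_on A \<eta>"
proof (rule continuous_onI)
  fix x e :: real assume "0 < e"
  then show "\<exists>d>0. \<forall>x'\<in>A. dist x' x < d \<longrightarrow> dist (\<eta> x') (\<eta> x) \<le> e"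
    using geodesic_line_dist[OF assms] by (intro exI[of _ e]) (auto simp: dist_real_def)
qed

lemma nearest_param_exists:
  assumes "geodesic_line \<eta>" shows "\<exists>t. nearest_param \<eta> x t"
proof -
  \<comment> \<open>For parameters beyond \<open>r\<close> in absolute value, the triangle
    inequality makes the point of the line at least as far from \<open>x\<close> as
    \<open>\<eta> 0\<close>, so a minimum over the compact interval is global.\<close>
  define r where "r = 2 * dist x (\<eta> 0)"
  have "r \<ge> 0" by (simp add: r_def)
  have "continuous_on {-r..r} (\<lambda>t. dist x (\<eta> t))"
    by (intro continuous_intros geodesic_line_continuous assms)
  then obtain t where t: "t \<in> {-r..r}" "\<And>s. s \<in> {-r..r} \<Longrightarrow> dist x (\<eta> t) \<le> dist x (\<eta> s)"
    using continuous_attains_inf[of "{-r..r}" "\<lambda>t. dist x (\<eta> t)"] \<open>r \<ge> 0\<close> by auto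
  have "dist x (\<eta> t) \<le> dist x (\<eta> s)" for s
  proof (cases "s \<in> {-r..r}")
    case False
    have "\<bar>s\<bar> \<le> dist x (\<eta> 0) + dist x (\<eta> s)"
      using geodesic_line_dist[OF assms, of s 0] dist_triangle3[of "\<eta> s" "\<eta> 0" x] by simp
    moreover have "\<bar>s\<bar> > r" using False by auto
    ultimately have "dist x (\<eta> 0) \<le> dist x (\<eta> s)" unfolding r_def by linarith
    then show ?thesis using t(2)[of 0] \<open>r \<ge> 0\<close> by simp
  qed (use t in auto)
  then show ?thesis unfolding nearest_param_def by blast
qed

lemma nearest_param_proj_param: "geodesic_line \<eta> \<Longrightarrow> nearest_param \<eta> x (proj_param \<eta> x)"
  unfolding proj_param_def by (rule someI_ex) (rule nearest_param_exists)

lemma line_dist_le: "geodesic_line \<eta> \<Longrightarrow> line_dist \<eta> x \<le> dist x (\<eta> s)"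
  using nearest_param_proj_param[of \<eta> x] unfolding nearest_param_def line_dist_def by blast

lemma line_dist_nonneg: "line_dist \<eta> x \<ge> 0"
  by (simp add: line_dist_def)

lemma line_dist_lipschitz: "geodesic_line \<eta> \<Longrightarrow> line_dist \<eta> x \<le> dist x y + line_dist \<eta> y"
  using line_dist_le[of \<eta> x "proj_param \<eta> y"] dist_triangle[of x "\<eta> (proj_param \<eta> y)" y]
  unfolding line_dist_def[of \<eta> y] by linarith

lemma dist_le_via_line:
  assumes "geodesic_line \<eta>"
  shows "dist x y \<le> line_dist \<eta> x + \<bar>proj_param \<eta> x - proj_param \<eta> y\<bar> + line_dist \<eta> y"
proof -
  let ?p = "\<eta> (proj_param \<eta> x)" and ?q = "\<eta> (proj_param \<eta> y)"
  have "dist x y \<le> dist x ?p + (dist ?p ?q + dist y ?q)"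
    by (metis dist_commute dist_triangle dist_triangle_le add_left_mono order_trans)
  then show ?thesis using geodesic_line_dist[OF assms] by (simp add: line_dist_def)
qed

lemma proj_diff_le_via_line:
  assumes "geodesic_line \<eta>"
  shows "\<bar>proj_param \<eta> x - proj_param \<eta> y\<bar> \<le> dist x y + line_dist \<eta> x + line_dist \<eta> y"
proof -
  let ?p = "\<eta> (proj_param \<eta> x)" and ?q = "\<eta> (proj_param \<eta> y)"
  have "dist ?p ?q \<le> dist x ?p + (dist x y + dist y ?q)"
    using dist_triangle3[of ?p ?q x] dist_triangle[of x ?q y] by linarith
  then show ?thesis using geodesic_line_dist[OF assms] by (simp add: line_dist_def)
qed

definition reverse_line :: "(real \<Rightarrow> 'x) \<Rightarrow> real \<Rightarrow> 'x" where
  "reverse_line \<eta> = (\<lambda>t. \<eta> (- t))"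

definition contracting_geodesic :: "real \<Rightarrow> (real \<Rightarrow> 'x::metric_space) \<Rightarrow> bool" where
  "contracting_geodesic C \<eta> \<longleftrightarrow> C > 0 \<and> geodesic_line \<eta> \<and> contracting_line C \<eta>"

lemma range_reverse_line: "range (reverse_line \<eta>) = range \<eta>"
proof -
  have "reverse_line \<eta> = \<eta> \<circ> uminus" by (auto simp: reverse_line_def)
  then show ?thesis by (metis image_comp surj_uminus)
qed

lemma contracting_geodesic_reverse:
  "contracting_geodesic C \<eta> \<Longrightarrow> contracting_geodesic C (reverse_line \<eta>)"
  unfolding contracting_geodesic_def contracting_line_def range_reverse_line
  by (auto simp: geodesic_line_def isometric_embedding_on_def reverse_line_def)

lemma contracting_geodesic_mono:
  "contracting_geodesic C \<eta> \<Longrightarrow> C \<le> C' \<Longrightarrow> contracting_geodesic C' \<eta>"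
  unfolding contracting_geodesic_def contracting_line_def by force

section \<open>Equivariance of projections under isometries\<close>

locale isometry =
  fixes f :: "'x::metric_space \<Rightarrow> 'x"
  assumes dist_image [simp]: "dist (f x) (f y) = dist x y" and surj: "surj f"
begin

lemma nearest_param_comp: "nearest_param (f \<circ> \<eta>) (f x) = nearest_param \<eta> x"
  by (rule ext) (simp add: nearest_param_def)

text \<open>Exact, not merely up to \<open>C\<close>: the two predicates fed to \<open>SOME\<close>
  are equal, so the same parameter is chosen.\<close>

lemma proj_param_comp: "proj_param (f \<circ> \<eta>) (f x) = proj_param \<eta> x"
  by (simp add: proj_param_def nearest_param_comp)

lemma line_dist_comp: "line_dist (f \<circ> \<eta>) (f x) = line_dist \<eta> x"
  by (simp add: line_dist_def proj_param_comp)

lemma nearest_points_image: "nearest_points (f ` A) (f x) = f ` nearest_points A x"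
  by (auto simp: nearest_points_def)

lemma ball_image: "ball (f x) r = f ` ball x r"
  using surj by (force simp: surj_def)

text \<open>Surjectivity enters here: every ball must be the image of a ball, so that disjointness
  from the line can be pulled back.\<close>

lemma contracting_geodesic_comp:
  assumes "contracting_geodesic C \<eta>" shows "contracting_geodesic C (f \<circ> \<eta>)"
proof -
  have inj: "inj f" by (metis dist_eq_0_iff dist_image injI)
  have "bounded (\<Union>y\<in>ball x r. nearest_points (range (f \<circ> \<eta>)) y) \<and>
        diameter (\<Union>y\<in>ball x r. nearest_points (range (f \<circ> \<eta>)) y) \<le> C"
    if "ball x r \<inter> range (f \<circ> \<eta>) = {}" for x r
  proof -
    obtain x' where x': "x = f x'" using surj by (metis surjD)
    let ?A = "\<Union>y\<in>ball x' r. nearest_points (range \<eta>) y"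
    have eq: "(\<Union>y\<in>ball x r. nearest_points (range (f \<circ> \<eta>)) y) = f ` ?A"
      unfolding x' ball_image image_comp[symmetric] by (auto simp: nearest_points_image)
    have "ball x' r \<inter> range \<eta> = {}"
      using that unfolding x' ball_image image_comp[symmetric] by auto
    then have A: "bounded ?A" "diameter ?A \<le> C"
      using assms unfolding contracting_geodesic_def contracting_line_def by blast+
    have "bounded (f ` ?A)"
    proof -
      obtain c e where "\<forall>y\<in>?A. dist c y \<le> e" using A(1) unfolding bounded_def by blast
      then have "\<forall>y\<in>f ` ?A. dist (f c) y \<le> e" by auto
      then show ?thesis unfolding bounded_def by blast
    qed
    moreover have "diameter (f ` ?A) = diameter ?A"
    proof -
      have "f ` A \<times> f ` A = map_prod f f ` (A \<times> A)" for A by auto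
      then show ?thesis
        unfolding diameter_def by (simp add: image_image case_prod_unfold del: image_UN)
    qed
    ultimately show ?thesis using A eq by simp
  qed
  then show ?thesis using assms
    unfolding contracting_geodesic_def contracting_line_def
    by (auto simp: geodesic_line_def isometric_embedding_on_def)
qed

end

section \<open>Contracting lines\<close>

lemma geodesic_segment_dist:
  "geodesic_segment \<sigma> x y \<Longrightarrow> u \<in> {0..dist x y} \<Longrightarrow> v \<in> {0..dist x y} \<Longrightarrow> dist (\<sigma> u) (\<sigma> v) = \<bar>u - v\<bar>"
  by (simp add: geodesic_segment_def isometric_embedding_on_def)

lemma geodesic_segment_ends:
  assumes "geodesic_segment \<sigma> x y" "u \<in> {0..dist x y}"
  shows "dist x (\<sigma> u) = u" "dist (\<sigma> u) y = dist x y - u"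
  using geodesic_segment_dist[OF assms(1), of 0 u] geodesic_segment_dist[OF assms(1), of u "dist x y"]
    assms by (auto simp: geodesic_segment_def)

locale contracting =
  fixes C :: real and \<eta> :: "real \<Rightarrow> 'x::metric_space"
  assumes contracting: "contracting_geodesic C \<eta>"
begin

abbreviation "T \<equiv> proj_param \<eta>"
abbreviation "D \<equiv> line_dist \<eta>"

lemma C_pos: "C > 0" and line: "geodesic_line \<eta>" and contr: "contracting_line C \<eta>"
  using contracting by (auto simp: contracting_geodesic_def)

text \<open>The open ball of radius \<open>D x\<close> about \<open>x\<close> misses the line and
  contains both points, so contraction bounds the diameter of the set of their nearest
  points.\<close>

lemma nearest_param_close:
  assumes "dist x y < D x" "nearest_param \<eta> x s" "nearest_param \<eta> y t"
  shows "\<bar>s - t\<bar> \<le> C"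
proof -
  let ?B = "\<Union>z\<in>ball x (D x). nearest_points (range \<eta>) z"
  have "ball x (D x) \<inter> range \<eta> = {}"
    using line_dist_le[OF line, of x] by (auto simp: disjoint_iff) (meson not_less)
  then have B: "bounded ?B" "diameter ?B \<le> C"
    using contr unfolding contracting_line_def by blast+
  have "D x > 0" using assms(1) zero_le_dist[of x y] by linarith
  then have "\<eta> s \<in> ?B" "\<eta> t \<in> ?B"
    using assms by (auto simp: nearest_points_def nearest_param_def)
  then have "dist (\<eta> s) (\<eta> t) \<le> C"
    using diameter_bounded_bound[OF B(1)] B(2) by fastforce
  then show ?thesis using geodesic_line_dist[OF line] by simp
qed

lemma nearest_param_unique:
  assumes "nearest_param \<eta> x s" shows "\<bar>s - T x\<bar> \<le> C"
proof (cases "D x > 0")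
  case True
  then show ?thesis using nearest_param_close[of x x s "T x"] assms nearest_param_proj_param[OF line] by simp
next
  case False
  then have "dist x (\<eta> (T x)) = 0" unfolding line_dist_def by simp
  moreover from this have "dist x (\<eta> s) = 0"
    using assms unfolding nearest_param_def by (metis zero_le_dist order_antisym)
  ultimately have "dist (\<eta> s) (\<eta> (T x)) = 0" by simp
  then show ?thesis using geodesic_line_dist[OF line] C_pos by simp
qed

lemma proj_close: "dist x y < D x \<Longrightarrow> \<bar>T x - T y\<bar> \<le> C"
  by (rule nearest_param_close) (auto intro: nearest_param_proj_param line)

text \<open>If neither point lies in the ball about the other that just misses the line, both are
  within \<open>dist x y\<close> of the line and the triangle inequality costs a factor 3. The form
  with \<open>max\<close> is what \<open>proj_intermediate_value\<close> uses: a move shorter than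
  C/3 shifts the projection by at most \<open>C\<close>.\<close>

lemma proj_coarse_lipschitz: "\<bar>T x - T y\<bar> \<le> max C (3 * dist x y)"
proof -
  consider "dist x y < D x" | "dist x y < D y" | "D x \<le> dist x y" "D y \<le> dist x y" by linarith
  then show ?thesis
  proof cases
    case 2
    then show ?thesis using proj_close[of y x] by (simp add: dist_commute)
  next
    case 3
    then show ?thesis using proj_diff_le_via_line[OF line, of x y] by linarith
  qed (use proj_close in force)
qed

lemma proj_lipschitz: "\<bar>T x - T y\<bar> \<le> C + 3 * dist x y"
  using proj_coarse_lipschitz[of x y] C_pos zero_le_dist[of x y] by linarith

lemma proj_on_line: "\<bar>T (\<eta> s) - s\<bar> \<le> C" "D (\<eta> s) = 0"
proof -
  have "nearest_param \<eta> (\<eta> s) s" by (simp add: nearest_param_def)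
  then show "\<bar>T (\<eta> s) - s\<bar> \<le> C" using nearest_param_unique[of "\<eta> s" s] by linarith
  show "D (\<eta> s) = 0"
    using line_dist_le[OF line, of "\<eta> s" s] line_dist_nonneg[of \<eta> "\<eta> s"] by simp
qed

lemma nearest_param_reverse:
  "nearest_param (reverse_line \<eta>) x t \<longleftrightarrow> nearest_param \<eta> x (- t)"
  unfolding nearest_param_def reverse_line_def by (metis add.inverse_inverse)

text \<open>Only up to \<open>C\<close>, because the choices for a line and for its reversal need
  not correspond.\<close>

lemma proj_reverse: "\<bar>proj_param (reverse_line \<eta>) x + T x\<bar> \<le> C"
proof -
  have "geodesic_line (reverse_line \<eta>)"
    using contracting_geodesic_reverse[OF contracting] by (simp add: contracting_geodesic_def)
  then have "nearest_param \<eta> x (- proj_param (reverse_line \<eta>) x)"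
    using nearest_param_proj_param nearest_param_reverse by blast
  then show ?thesis using nearest_param_unique by fastforce
qed

lemma line_dist_reverse: "line_dist (reverse_line \<eta>) x = D x"
proof -
  have l: "geodesic_line (reverse_line \<eta>)"
    using contracting_geodesic_reverse[OF contracting] by (simp add: contracting_geodesic_def)
  have "line_dist (reverse_line \<eta>) x \<le> D x"
    using line_dist_le[OF l, of x "- T x"] by (simp add: line_dist_def reverse_line_def)
  moreover have "D x \<le> line_dist (reverse_line \<eta>) x"
    using line_dist_le[OF line, of x "- proj_param (reverse_line \<eta>) x"]
    by (simp add: line_dist_def reverse_line_def)
  ultimately show ?thesis by simp
qed

text \<open>Outside the 2C-neighbourhood a step of length at most 2C stays in a ball missing the
  line, so it moves the projection by at most \<open>C\<close>: this is half speed. The additive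
  \<open>C\<close> pays for rounding the number of steps up.\<close>

lemma march:
  assumes geo: "geodesic_segment \<sigma> x y" and ab: "0 \<le> a" "a \<le> b" "b \<le> dist x y"
    and far: "\<And>u. a \<le> u \<Longrightarrow> u < b \<Longrightarrow> D (\<sigma> u) > 2 * C"
  shows "\<bar>T (\<sigma> a) - T (\<sigma> b)\<bar> \<le> (b - a) / 2 + C"
proof -
  have *: "\<bar>T (\<sigma> a) - T (\<sigma> c)\<bar> \<le> real n * C"
    if "a \<le> c" "c \<le> b" "c - a \<le> 2 * C * real n" for n c
    using that
  proof (induction n arbitrary: c)
    case (Suc n)
    show ?case
    proof (cases "c - a \<le> 2 * C * real n")
      case True
      then show ?thesis using Suc.IH[of c] Suc.prems C_pos by (auto simp: algebra_simps)
    next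
      case False
      define c' where "c' = max a (c - 2 * C)"
      have "0 \<le> 2 * C * real n" using C_pos by simp
      then have "a < c" using False by linarith
      then have c': "a \<le> c'" "c' < c" "c' \<le> b" "c' - a \<le> 2 * C * real n" "c - c' \<le> 2 * C"
        using Suc.prems C_pos unfolding c'_def by (auto simp: algebra_simps)
      have "D (\<sigma> c') > 2 * C" using far c' Suc.prems by auto
      moreover have "dist (\<sigma> c') (\<sigma> c) = c - c'"
        using geodesic_segment_dist[OF geo, of c' c] c' Suc.prems ab by auto
      ultimately have "\<bar>T (\<sigma> c') - T (\<sigma> c)\<bar> \<le> C" using proj_close[of "\<sigma> c'" "\<sigma> c"] c' by simp
      moreover have "\<bar>T (\<sigma> a) - T (\<sigma> c')\<bar> \<le> real n * C" using Suc.IH[of c'] c' by simp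
      ultimately show ?thesis by (simp add: algebra_simps)
    qed
  qed simp
  define n where "n = nat \<lceil>(b - a) / (2 * C)\<rceil>"
  have nn: "(b - a) / (2 * C) \<ge> 0" using ab C_pos by simp
  have n: "(b - a) / (2 * C) \<le> real n" "real n \<le> (b - a) / (2 * C) + 1"
    using nn unfolding n_def by linarith+
  then have "b - a \<le> 2 * C * real n" using C_pos by (simp add: field_simps)
  then have "\<bar>T (\<sigma> a) - T (\<sigma> b)\<bar> \<le> real n * C" using * ab by simp
  also have "\<dots> \<le> ((b - a) / (2 * C) + 1) * C" using n(2) C_pos by (intro mult_right_mono) auto
  also have "\<dots> = (b - a) / 2 + C" using C_pos by (simp add: field_simps)
  finally show ?thesis .
qed

text \<open>The time \<open>a\<close> is the first at which the closed 2C-neighbourhood is reached.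
  Before it the projection lags behind, so the time spent pays for both the approach
  \<open>D x\<close> and the shift of the projection.\<close>

lemma first_entry:
  assumes geo: "geodesic_segment \<sigma> x y" and w: "w \<in> {0..dist x y}" "D (\<sigma> w) \<le> 2 * C"
  obtains a where "a \<in> {0..dist x y}" "D (\<sigma> a) \<le> 2 * C" "a \<ge> D x + \<bar>T x - T (\<sigma> a)\<bar> - 3 * C"
proof -
  let ?L = "dist x y"
  let ?S = "{u \<in> {0..?L}. D (\<sigma> u) \<le> 2 * C}"
  have "continuous_on {0..?L} (\<lambda>u. D (\<sigma> u))"
  proof (rule continuous_onI)
    fix u e :: real assume ue: "u \<in> {0..?L}" "0 < e"
    have "dist (D (\<sigma> v)) (D (\<sigma> u)) \<le> e" if v: "v \<in> {0..?L}" "dist v u < e" for v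
      using line_dist_lipschitz[OF line, of "\<sigma> u" "\<sigma> v"] line_dist_lipschitz[OF line, of "\<sigma> v" "\<sigma> u"]
        geodesic_segment_dist[OF geo, of u v] geodesic_segment_dist[OF geo, of v u] ue v
      unfolding dist_real_def by linarith
    then show "\<exists>d>0. \<forall>x'\<in>{0..?L}. dist x' u < d \<longrightarrow> dist (D (\<sigma> x')) (D (\<sigma> u)) \<le> e"
      using ue by blast
  qed
  then have "closed ({0..?L} \<inter> (\<lambda>u. D (\<sigma> u)) -` {..2 * C})"
    by (intro continuous_closed_preimage) auto
  moreover have "?S = {0..?L} \<inter> ({0..?L} \<inter> (\<lambda>u. D (\<sigma> u)) -` {..2 * C})" by auto
  ultimately have "compact ?S" by (metis compact_Icc compact_Int_closed)
  moreover have "?S \<noteq> {}" using w by blast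
  ultimately obtain a where a: "a \<in> ?S" "\<And>u. u \<in> ?S \<Longrightarrow> a \<le> u"
    using compact_attains_inf[of ?S] by blast
  have x: "\<sigma> 0 = x" using geo by (simp add: geodesic_segment_def)
  have da: "dist x (\<sigma> a) = a" using geodesic_segment_ends[OF geo] a by auto
  have far: "D (\<sigma> u) > 2 * C" if "0 \<le> u" "u < a" for u
    using a(2)[of u] a(1) that by force
  have "a \<ge> D x + \<bar>T x - T (\<sigma> a)\<bar> - 3 * C"
  proof (cases "a < D x")
    case True
    then have "\<bar>T x - T (\<sigma> a)\<bar> \<le> C" using proj_close da by simp
    moreover have "D x \<le> a + 2 * C" using line_dist_lipschitz[OF line, of x "\<sigma> a"] da a(1) by simp
    ultimately show ?thesis by simp
  next
    case False
    show ?thesis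
    proof (cases "a = 0")
      case True
      then show ?thesis using False x C_pos line_dist_nonneg[of \<eta> x] by simp
    next
      case False
      then have "D x > 2 * C" using far[of 0] x a(1) by auto
      \<comment> \<open>Before time \<open>D x\<close> the projection has moved by at most
        \<open>C\<close>; only the stretch from \<open>a'\<close> to \<open>a\<close> is charged at
        half speed. Stopping \<open>C\<close> short of \<open>D x\<close> makes the inequality for
        the ball strict.\<close>
      define a' where "a' = D x - C"
      have a': "0 \<le> a'" "a' < a" "a' < D x"
        unfolding a'_def using \<open>D x > 2 * C\<close> C_pos \<open>\<not> a < D x\<close> by linarith+
      have "\<bar>T (\<sigma> a') - T (\<sigma> a)\<bar> \<le> (a - a') / 2 + C"
        by (rule march[OF geo]) (use a' a far in auto)
      moreover have "\<bar>T x - T (\<sigma> a')\<bar> \<le> C"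
        by (rule proj_close) (use geodesic_segment_ends(1)[OF geo, of a'] a a' in auto)
      ultimately have "\<bar>T x - T (\<sigma> a)\<bar> \<le> (a - D x + C) / 2 + 2 * C" unfolding a'_def by argo
      moreover have "(a - D x) / 2 \<le> a - D x" using \<open>\<not> a < D x\<close> by simp
      ultimately show ?thesis using C_pos by argo
    qed
  qed
  then show ?thesis using that a by blast
qed

end

locale contracting_in_geodesic_space = contracting C \<eta> for C and \<eta> :: "real \<Rightarrow> 'x::metric_space" +
  assumes geodesic_ex: "\<And>x y :: 'x. \<exists>\<sigma>. geodesic_segment \<sigma> x y"
begin

text \<open>The path is split at its first entry, which costs 3C. The entry point and
  \<open>y\<close> are both within 2C of the line, which costs another 4C.\<close>

lemma dist_ge_to_near_line:
  assumes "D y \<le> 2 * C"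
  shows "dist x y \<ge> D x + \<bar>T x - T y\<bar> - 7 * C"
proof -
  obtain \<sigma> where geo: "geodesic_segment \<sigma> x y" using geodesic_ex by blast
  have "\<sigma> (dist x y) = y" using geo by (simp add: geodesic_segment_def)
  then obtain a where a: "a \<in> {0..dist x y}" "D (\<sigma> a) \<le> 2 * C" "a \<ge> D x + \<bar>T x - T (\<sigma> a)\<bar> - 3 * C"
    using first_entry[OF geo, of "dist x y"] assms by auto
  have "dist x y = a + dist (\<sigma> a) y" using geodesic_segment_ends[OF geo a(1)] by simp
  moreover have "\<bar>T (\<sigma> a) - T y\<bar> \<le> dist (\<sigma> a) y + 2 * C + 2 * C"
    using proj_diff_le_via_line[OF line, of "\<sigma> a" y] a assms by simp
  ultimately show ?thesis using a(3) by linarith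
qed

text \<open>
  A geodesic joining two points with distant projections must run along the line: off the
  \<open>2C\<close>-neighbourhood of the line it progresses at most at half speed.
\<close>

lemma dist_ge_via_line:
  assumes "\<bar>T x - T y\<bar> > 8 * C"
  shows "dist x y \<ge> D x + D y + \<bar>T x - T y\<bar> - 14 * C"
proof -
  obtain \<sigma> where geo: "geodesic_segment \<sigma> x y" using geodesic_ex by blast
  let ?L = "dist x y"
  show ?thesis
  proof (cases "\<exists>w\<in>{0..?L}. D (\<sigma> w) \<le> 2 * C")
    \<comment> \<open>At a point near the line the estimate with loss 7C applies on either side,
      whence 14C.\<close>
    case True
    then obtain w where w: "w \<in> {0..?L}" "D (\<sigma> w) \<le> 2 * C" by blast
    have "dist x (\<sigma> w) \<ge> D x + \<bar>T x - T (\<sigma> w)\<bar> - 7 * C" "dist y (\<sigma> w) \<ge> D y + \<bar>T y - T (\<sigma> w)\<bar> - 7 * C"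
      using dist_ge_to_near_line w by auto
    moreover have "?L = dist x (\<sigma> w) + dist y (\<sigma> w)"
      using geodesic_segment_ends[OF geo w(1)] by (simp add: dist_commute)
    ultimately show ?thesis by linarith
  next
    case False
    have far: "D (\<sigma> w) > 2 * C" if "w \<in> {0..?L}" for w using False that by force
    have ends: "\<sigma> 0 = x" "\<sigma> ?L = y" using geo by (auto simp: geodesic_segment_def)
    have Dx: "D x > 2 * C" and Dy: "D y > 2 * C" using far[of 0] far[of ?L] ends by auto
    have Lx: "D x \<le> ?L" using proj_close[of x y] assms C_pos by force
    have Ly: "D y \<le> ?L" using proj_close[of y x] assms C_pos by (force simp: dist_commute)
    \<comment> \<open>On the initial piece of length \<open>a\<close> and on the final piece from
      \<open>b\<close> on, the projection moves by at most \<open>C\<close>. If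
      \<open>a \<le> b\<close>, \<open>march\<close> controls the middle, and comparison with
      \<open>dist_le_via_line\<close> forces the projections to within 8C of each other; if
      \<open>b < a\<close>, to within 2C. Both contradict the assumption, so this case is
      void.\<close>
    define a where "a = D x - C"
    define b where "b = ?L - D y + C"
    have a: "a \<in> {0..?L}" "a < D x" and b: "b \<in> {0..?L}" "?L - b < D y"
      using Dx Dy Lx Ly C_pos by (auto simp: a_def b_def)
    have xa: "\<bar>T x - T (\<sigma> u)\<bar> \<le> C" if "u \<in> {0..?L}" "u < D x" for u
      using geodesic_segment_ends(1)[OF geo that(1)] that by (auto intro: proj_close)
    have yb: "\<bar>T y - T (\<sigma> b)\<bar> \<le> C"
      using geodesic_segment_ends(2)[OF geo b(1)] b by (auto intro: proj_close simp: dist_commute)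
    show ?thesis
    proof (cases "a \<le> b")
      case True
      have "\<bar>T (\<sigma> a) - T (\<sigma> b)\<bar> \<le> (b - a) / 2 + C"
        by (rule march[OF geo]) (use a b True far in auto)
      then have "\<bar>T x - T y\<bar> \<le> (?L - D x - D y) / 2 + 4 * C"
        using xa[OF a] yb unfolding a_def b_def by argo
      then show ?thesis using dist_le_via_line[OF line, of x y] assms by argo
    next
      case False
      then have "\<bar>T x - T (\<sigma> b)\<bar> \<le> C" using xa[of b] a b by auto
      then show ?thesis using yb assms C_pos by argo
    qed
  qed
qed

text \<open>The projection need not be continuous along the segment. It is sampled at steps shorter
  than C/3, where it jumps by at most \<open>C\<close>; the first sample reaching \<open>c\<close>
  overshoots by at most that.\<close>

lemma proj_intermediate_value:
  assumes geo: "geodesic_segment \<sigma> x y" and "T x \<le> c" "c \<le> T y"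
  obtains u where "u \<in> {0..dist x y}" "\<bar>T (\<sigma> u) - c\<bar> \<le> C"
proof -
  let ?L = "dist x y"
  obtain n :: nat where "?L / (C / 3) < real n" using reals_Archimedean2 by blast
  moreover from this have "n > 0" using C_pos zero_le_dist[of x y]
    by (metis divide_nonneg_pos gr0I of_nat_0 not_less zero_less_divide_iff zero_less_numeral)
  ultimately have n: "n > 0" "?L / n < C / 3" using C_pos by (auto simp: field_simps)
  define p where "p i = \<sigma> (?L * real i / real n)" for i
  have mem: "?L * real i / real n \<in> {0..?L}" if "i \<le> n" for i
  proof -
    have "?L * real i \<le> ?L * real n" using that by (intro mult_left_mono) auto
    then show ?thesis using n by (simp add: field_simps)
  qed
  have "p 0 = x" "p n = y" using geo n by (auto simp: p_def geodesic_segment_def)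
  define i where "i = (LEAST i. T (p i) \<ge> c)"
  have i: "T (p i) \<ge> c" and "i \<le> n"
    unfolding i_def using \<open>p n = y\<close> assms by (auto intro: LeastI[of _ n] Least_le)
  show ?thesis
  proof (cases i)
    case 0
    then show ?thesis using that[of 0] i \<open>p 0 = x\<close> assms C_pos by (auto simp: p_def)
  next
    case (Suc j)
    then have j: "T (p j) < c" unfolding i_def using not_less_Least[of j "\<lambda>i. T (p i) \<ge> c"] by (simp add: not_le)
    have "dist (p j) (p i) = \<bar>?L * real j / real n - ?L * real i / real n\<bar>"
      unfolding p_def using \<open>i \<le> n\<close> Suc by (intro geodesic_segment_dist[OF geo] mem) simp_all
    also have "\<dots> = ?L / n" using n Suc by (simp add: field_simps)
    finally have "dist (p j) (p i) < C / 3" using n by linarith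
    then have "\<bar>T (p j) - T (p i)\<bar> \<le> C" using proj_coarse_lipschitz[of "p j" "p i"] by linarith
    then have "\<bar>T (p i) - c\<bar> \<le> C" using i j by linarith
    then show ?thesis using that[OF mem[OF \<open>i \<le> n\<close>]] by (simp add: p_def)
  qed
qed

text \<open>A point \<open>z\<close> of the segment projecting to within \<open>C\<close> of
  \<open>c\<close> is still more than 8C from both ends in projection, so
  \<open>dist_ge_via_line\<close> applies twice. The sum contains \<open>D z\<close> twice and loses
  28C, while the total length is at most the path via the line; hence
  \<open>D z \<le> 14 * C\<close>.\<close>

lemma geodesic_passes_near:
  assumes geo: "geodesic_segment \<sigma> x y" and c: "T x + 10 * C \<le> c" "c + 10 * C \<le> T y"
  obtains u where "u \<in> {0..dist x y}" "dist (\<sigma> u) (\<eta> c) \<le> 15 * C"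
proof -
  obtain u where u: "u \<in> {0..dist x y}" "\<bar>T (\<sigma> u) - c\<bar> \<le> C"
    using proj_intermediate_value[OF geo, of c] c C_pos by auto
  let ?z = "\<sigma> u"
  have "dist x ?z \<ge> D x + D ?z + \<bar>T x - T ?z\<bar> - 14 * C"
    by (rule dist_ge_via_line) (use u c C_pos in linarith)
  moreover have "dist ?z y \<ge> D ?z + D y + \<bar>T ?z - T y\<bar> - 14 * C"
    by (rule dist_ge_via_line) (use u c C_pos in linarith)
  moreover have "dist x y = dist x ?z + dist ?z y"
    using geodesic_segment_ends[OF geo u(1)] by simp
  ultimately have "D ?z \<le> 14 * C" using dist_le_via_line[OF line, of x y] by linarith
  then have "dist ?z (\<eta> c) \<le> 14 * C + \<bar>T ?z - c\<bar>"
    using dist_triangle[of ?z "\<eta> c" "\<eta> (T ?z)"] geodesic_line_dist[OF line, of "T ?z" c]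
    by (simp add: line_dist_def)
  then show ?thesis using that u by force
qed

text \<open>An excursion of the projection to depth 14C below \<open>s\<close> is travelled there
  and back. This exceeds the two losses of 14C and makes the segment longer than the path via the
  line.\<close>

lemma half_space_quasiconvex:
  assumes geo: "geodesic_segment \<sigma> x y" and "s \<le> T x" "s \<le> T y" and u: "u \<in> {0..dist x y}"
  shows "T (\<sigma> u) \<ge> s - 14 * C"
proof (rule ccontr)
  let ?z = "\<sigma> u"
  assume less: "\<not> T ?z \<ge> s - 14 * C"
  have "dist x ?z \<ge> D x + D ?z + \<bar>T x - T ?z\<bar> - 14 * C"
    by (rule dist_ge_via_line) (use less assms C_pos in linarith)
  moreover have "dist ?z y \<ge> D ?z + D y + \<bar>T ?z - T y\<bar> - 14 * C"
    by (rule dist_ge_via_line) (use less assms C_pos in linarith)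
  moreover have "dist x y = dist x ?z + dist ?z y"
    using geodesic_segment_ends[OF geo u(1)] by simp
  ultimately show False
    using dist_le_via_line[OF line, of x y] line_dist_nonneg[of \<eta> ?z] less assms by argo
qed

end

section \<open>Half-spaces, gates and convergence to the boundary\<close>

lemma geodesic_segment_on_line:
  assumes "geodesic_line \<gamma>"
  shows "geodesic_segment (\<lambda>u. \<gamma> (r + sgn (r' - r) * u)) (\<gamma> r) (\<gamma> r')"
proof -
  have "isometric_embedding_on {0..\<bar>r - r'\<bar>} (\<lambda>u. \<gamma> (r + sgn (r' - r) * u))"
  proof (cases "r = r'")
    case False
    then have "\<bar>sgn (r' - r) * s - sgn (r' - r) * t\<bar> = \<bar>s - t\<bar>" for s t
      by (simp add: right_diff_distrib[symmetric] abs_mult abs_sgn_eq)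
    then show ?thesis
      unfolding isometric_embedding_on_def by (simp add: geodesic_line_dist[OF assms])
  qed (auto simp: isometric_embedding_on_def)
  moreover have "r + sgn (r' - r) * \<bar>r - r'\<bar> = r'" by (auto simp: sgn_real_def)
  ultimately show ?thesis
    unfolding geodesic_segment_def by (simp add: geodesic_line_dist[OF assms])
qed

text \<open>
  If a deep half-space of \<open>\<eta>\<close> has large projection to \<open>\<gamma>\<close>, then \<open>\<gamma>\<close> must enter the half-space
  through the gate \<open>\<eta> (s - 70 * C)\<close>.
\<close>

lemma line_through_gate:
  fixes \<eta> \<gamma> :: "real \<Rightarrow> 'x::metric_space"
  assumes geo: "\<And>x y :: 'x. \<exists>\<sigma>. geodesic_segment \<sigma> x y"
    and \<eta>: "contracting_geodesic C \<eta>" and \<gamma>: "contracting_geodesic C \<gamma>"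
    and deep: "proj_param \<eta> b + 81 * C + 3 * line_dist \<gamma> b \<le> s"
    and xy: "s \<le> proj_param \<eta> x" "s \<le> proj_param \<eta> y"
      "\<bar>proj_param \<gamma> x - proj_param \<gamma> y\<bar> > 20 * C"
  obtains r where "dist (\<gamma> r) (\<eta> (s - 70 * C)) \<le> 15 * C"
proof -
  interpret \<eta>: contracting_in_geodesic_space C \<eta> by unfold_locales (use geo \<eta> in auto)
  interpret \<gamma>: contracting_in_geodesic_space C \<gamma> by unfold_locales (use geo \<gamma> in auto)
  note found = that
  have *: thesis if xy: "s \<le> \<eta>.T x" "s \<le> \<eta>.T y" "\<gamma>.T x + 20 * C < \<gamma>.T y" for x y
  proof -
    obtain \<sigma> where \<sigma>: "geodesic_segment \<sigma> x y" using geo by blast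
    \<comment> \<open>The midpoint of the two projections leaves the margin 10C required by
      \<open>geodesic_passes_near\<close> on either side.\<close>
    define c where "c = (\<gamma>.T x + \<gamma>.T y) / 2"
    have "\<gamma>.T x + 10 * C \<le> c" "c + 10 * C \<le> \<gamma>.T y" using xy unfolding c_def by argo+
    then obtain u where u: "u \<in> {0..dist x y}" "dist (\<sigma> u) (\<gamma> c) \<le> 15 * C"
      using \<gamma>.geodesic_passes_near[OF \<sigma>] by blast
    have "\<eta>.T (\<sigma> u) \<ge> s - 14 * C" by (rule \<eta>.half_space_quasiconvex[OF \<sigma> _ _ u(1)]) (use xy in auto)
    then have w: "\<eta>.T (\<gamma> c) \<ge> s - 60 * C"
      using \<eta>.proj_lipschitz[of "\<sigma> u" "\<gamma> c"] u by linarith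
    \<comment> \<open>The point of \<open>\<gamma>\<close> nearest to \<open>b\<close> projects to
      \<open>\<eta>\<close> at most at s - 80C, whereas \<open>\<gamma> c\<close> projects at least
      at s - 60C, namely 14C from quasiconvexity and 46C from the Lipschitz bound over a distance
      15C. The gate at s - 70C lies between them with margin 10C on both sides.\<close>
    let ?r0 = "\<gamma>.T b"
    have o1: "\<eta>.T (\<gamma> ?r0) + 10 * C \<le> s - 70 * C"
      using \<eta>.proj_lipschitz[of b "\<gamma> ?r0"] deep unfolding line_dist_def by linarith
    have "s - 70 * C + 10 * C \<le> \<eta>.T (\<gamma> c)" using w by linarith
    then obtain v where "dist (\<gamma> (?r0 + sgn (c - ?r0) * v)) (\<eta> (s - 70 * C)) \<le> 15 * C"
      using \<eta>.geodesic_passes_near[OF geodesic_segment_on_line[OF \<gamma>.line] o1] by blast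
    then show thesis by (rule found)
  qed
  show thesis using *[of x y] *[of y x] xy by linarith
qed

text \<open>If both axes entered through the gate, they would come within 30C of each other there;
  \<open>diverge\<close> then keeps the gate within a fixed distance of \<open>b\<close>,
  contradicting its depth.\<close>

lemma deep_half_space_small_projection:
  fixes \<gamma>\<^sub>1 \<gamma>\<^sub>2 :: "real \<Rightarrow> 'x::metric_space"
  assumes geo: "\<And>x y :: 'x. \<exists>\<sigma>. geodesic_segment \<sigma> x y"
    and \<gamma>: "contracting_geodesic C \<gamma>\<^sub>1" "contracting_geodesic C \<gamma>\<^sub>2"
    and diverge: "\<And>R. \<exists>M. \<forall>r\<^sub>1 r\<^sub>2. dist (\<gamma>\<^sub>1 r\<^sub>1) (\<gamma>\<^sub>2 r\<^sub>2) \<le> R \<longrightarrow> dist b (\<gamma>\<^sub>1 r\<^sub>1) \<le> M"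
  obtains E where "\<And>\<eta> s. contracting_geodesic C \<eta> \<Longrightarrow> proj_param \<eta> b + E \<le> s \<Longrightarrow>
     \<exists>\<gamma>\<in>{\<gamma>\<^sub>1, \<gamma>\<^sub>2}. \<forall>x y. s \<le> proj_param \<eta> x \<longrightarrow> s \<le> proj_param \<eta> y \<longrightarrow>
       \<bar>proj_param \<gamma> x - proj_param \<gamma> y\<bar> \<le> 20 * C"
proof -
  have C: "C > 0" using \<gamma> by (simp add: contracting_geodesic_def)
  obtain M where M: "\<And>r\<^sub>1 r\<^sub>2. dist (\<gamma>\<^sub>1 r\<^sub>1) (\<gamma>\<^sub>2 r\<^sub>2) \<le> 30 * C \<Longrightarrow> dist b (\<gamma>\<^sub>1 r\<^sub>1) \<le> M"
    using diverge by blast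
  \<comment> \<open>The first three terms meet the depth demanded by
    \<open>line_through_gate\<close>; the rest exceeds the projection shift allowed by the bound
    \<open>\<bar>M\<bar> + 15 * C\<close> on the distance from \<open>b\<close> to the gate.\<close>
  define E where "E = 81 * C + 3 * line_dist \<gamma>\<^sub>1 b + 3 * line_dist \<gamma>\<^sub>2 b + 3 * \<bar>M\<bar> + 200 * C"
  show thesis
  proof (rule that[of E])
    fix \<eta> :: "real \<Rightarrow> 'x" and s
    assume \<eta>: "contracting_geodesic C \<eta>" and deep: "proj_param \<eta> b + E \<le> s"
    interpret \<eta>: contracting_in_geodesic_space C \<eta> by unfold_locales (use geo \<eta> in auto)
    show "\<exists>\<gamma>\<in>{\<gamma>\<^sub>1, \<gamma>\<^sub>2}. \<forall>x y. s \<le> proj_param \<eta> x \<longrightarrow> s \<le> proj_param \<eta> y \<longrightarrow>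
       \<bar>proj_param \<gamma> x - proj_param \<gamma> y\<bar> \<le> 20 * C"
    proof (rule ccontr)
      assume "\<not> ?thesis"
      then obtain x\<^sub>1 y\<^sub>1 x\<^sub>2 y\<^sub>2 where
        1: "s \<le> \<eta>.T x\<^sub>1" "s \<le> \<eta>.T y\<^sub>1" "\<bar>proj_param \<gamma>\<^sub>1 x\<^sub>1 - proj_param \<gamma>\<^sub>1 y\<^sub>1\<bar> > 20 * C" and
        2: "s \<le> \<eta>.T x\<^sub>2" "s \<le> \<eta>.T y\<^sub>2" "\<bar>proj_param \<gamma>\<^sub>2 x\<^sub>2 - proj_param \<gamma>\<^sub>2 y\<^sub>2\<bar> > 20 * C"
        by (auto simp: not_le)
      have d: "\<eta>.T b + 81 * C + 3 * line_dist \<gamma>\<^sub>1 b \<le> s" "\<eta>.T b + 81 * C + 3 * line_dist \<gamma>\<^sub>2 b \<le> s"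
        using deep line_dist_nonneg[of \<gamma>\<^sub>1 b] line_dist_nonneg[of \<gamma>\<^sub>2 b] C unfolding E_def by linarith+
      let ?q = "\<eta> (s - 70 * C)"
      obtain r\<^sub>1 where r1: "dist (\<gamma>\<^sub>1 r\<^sub>1) ?q \<le> 15 * C"
        using line_through_gate[OF geo \<eta> \<gamma>(1) d(1) 1] by blast
      obtain r\<^sub>2 where r2: "dist (\<gamma>\<^sub>2 r\<^sub>2) ?q \<le> 15 * C"
        using line_through_gate[OF geo \<eta> \<gamma>(2) d(2) 2] by blast
      have "dist (\<gamma>\<^sub>1 r\<^sub>1) (\<gamma>\<^sub>2 r\<^sub>2) \<le> 30 * C" using r1 r2 dist_triangle2[of "\<gamma>\<^sub>1 r\<^sub>1" "\<gamma>\<^sub>2 r\<^sub>2" ?q] by linarith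
      then have "dist b (\<gamma>\<^sub>1 r\<^sub>1) \<le> M" using M by blast
      then have "dist b ?q \<le> \<bar>M\<bar> + 15 * C" using r1 dist_triangle[of b ?q "\<gamma>\<^sub>1 r\<^sub>1"] by linarith
      moreover have "\<eta>.T ?q \<ge> s - 71 * C" using \<eta>.proj_on_line(1)[of "s - 70 * C"] by linarith
      ultimately show False
        using \<eta>.proj_lipschitz[of b ?q] deep C line_dist_nonneg[of \<gamma>\<^sub>1 b] line_dist_nonneg[of \<gamma>\<^sub>2 b]
        unfolding E_def by argo
    qed
  qed
qed

section \<open>CAT(0) comparison and convergence in the cone topology\<close>

lemma CAT0_geodesic_exists: "CAT0_space TYPE('x::metric_space) \<Longrightarrow> \<exists>\<sigma>. geodesic_segment \<sigma> (x::'x) y"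
  by (simp add: CAT0_space_def)

text \<open>Truncating both segments at \<open>s\<close> gives an isosceles triangle, whose
  comparison triangle is written out in coordinates with base \<open>d\<close> and height
  \<open>h\<close>. The comparison points at distance \<open>t\<close> from the apex arise by
  scaling with ratio t/s.\<close>

lemma CAT0_geodesics_convex:
  fixes \<alpha> \<beta> :: "real \<Rightarrow> 'x::metric_space"
  assumes CAT0: "CAT0_space TYPE('x)"
    and \<alpha>: "geodesic_segment \<alpha> p q" and \<beta>: "geodesic_segment \<beta> p r"
    and s: "0 < s" "s \<le> dist p q" "s \<le> dist p r" and t: "0 \<le> t" "t \<le> s"
  shows "dist (\<alpha> t) (\<beta> t) \<le> t / s * dist (\<alpha> s) (\<beta> s)"
proof -
  define d where "d = dist (\<alpha> s) (\<beta> s)"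
  have ps: "dist p (\<alpha> s) = s" "dist p (\<beta> s) = s"
    using geodesic_segment_ends(1)[OF \<alpha>, of s] geodesic_segment_ends(1)[OF \<beta>, of s] s by auto
  have d: "0 \<le> d" "d \<le> 2 * s"
    using dist_triangle3[of "\<alpha> s" "\<beta> s" p] ps unfolding d_def by auto
  have \<alpha>': "geodesic_segment \<alpha> p (\<alpha> s)" and \<beta>': "geodesic_segment \<beta> p (\<beta> s)"
    using \<alpha> \<beta> s by (auto simp: geodesic_segment_def isometric_embedding_on_def ps)
  define h where "h = sqrt (s\<^sup>2 - (d / 2)\<^sup>2)"
  have "(d / 2)\<^sup>2 \<le> s\<^sup>2" using d by (intro power_mono) auto
  then have h: "(d / 2)\<^sup>2 + h\<^sup>2 = s\<^sup>2" unfolding h_def by simp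
  define p' q' r' :: "real^2" where
    "p' = h *\<^sub>R axis 2 1" and "q' = (d / 2) *\<^sub>R axis 1 1" and "r' = - (d / 2) *\<^sub>R axis 1 1"
  have nrm: "norm (a *\<^sub>R axis 1 1 + c *\<^sub>R axis 2 1 :: real^2) = sqrt (a\<^sup>2 + c\<^sup>2)" for a c :: real
    by (simp add: norm_vec_def L2_set_def sum_2 axis_def)
  have pq: "dist p' q' = s" "dist p' r' = s"
    using nrm[of "- (d / 2)" h] nrm[of "d / 2" h] h s
    by (simp_all add: dist_norm p'_def q'_def r'_def algebra_simps)
  have qr: "dist q' r' = d"
    using nrm[of d 0] d by (simp add: dist_norm q'_def r'_def flip: scaleR_add_left)
  define x' y' where "x' = p' + (t / s) *\<^sub>R (q' - p')" and "y' = p' + (t / s) *\<^sub>R (r' - p')"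
  have ts: "0 \<le> t / s" "t / s \<le> 1" using s t by auto
  have x': "x' \<in> closed_segment p' q'" "y' \<in> closed_segment p' r'"
    using ts unfolding x'_def y'_def in_segment
    by (auto intro!: exI[of _ "t / s"] simp: algebra_simps)
  have dx: "dist p' x' = t" "dist p' y' = t"
    using pq ts s unfolding x'_def y'_def by (auto simp: dist_norm norm_minus_commute abs_of_nonneg[OF t(1)])
  have "x' - y' = (t / s) *\<^sub>R (q' - r')" unfolding x'_def y'_def by (simp add: algebra_simps)
  then have dxy: "dist x' y' = t / s * d" using qr s t by (simp add: dist_norm)
  have "dist (\<alpha> t) (\<beta> t) \<le> dist x' y'"
    using CAT0 \<alpha>' \<beta>' pq qr x' dx t unfolding CAT0_space_def ps d_def[symmetric] 
    by (auto simp: ps d_def[symmetric] dest!: spec2)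
  then show ?thesis using dxy d_def by simp
qed

text \<open>\<open>K\<close> is fixed while \<open>y\<close> recedes: two late geodesics are
  boundedly close at a far point, so by convexity they are arbitrarily close on a compact initial
  interval, and completeness supplies the limit ray.\<close>

lemma converges_to_boundary:
  fixes z :: "nat \<Rightarrow> 'x::complete_space"
  assumes CAT0: "CAT0_space TYPE('x)"
    and passes: "\<And>R. \<exists>y. dist b y \<ge> R \<and> (\<forall>\<^sub>F n in sequentially.
       \<forall>\<sigma>. geodesic_segment \<sigma> b (z n) \<longrightarrow> (\<exists>u\<in>{0..dist b (z n)}. dist (\<sigma> u) y \<le> K))"
  shows "\<exists>\<xi>\<in>visual_boundary. limitin (cone_topology b) (\<lambda>n. Interior (z n)) (Ideal \<xi>) sequentially"
proof -
  have K: "K \<ge> 0"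
  proof -
    obtain y where "\<forall>\<^sub>F n in sequentially. \<forall>\<sigma>. geodesic_segment \<sigma> b (z n) \<longrightarrow> (\<exists>u\<in>{0..dist b (z n)}. dist (\<sigma> u) y \<le> K)"
      using passes by blast
    then obtain n where n: "\<forall>\<sigma>. geodesic_segment \<sigma> b (z n) \<longrightarrow> (\<exists>u\<in>{0..dist b (z n)}. dist (\<sigma> u) y \<le> K)"
      unfolding eventually_sequentially by blast
    obtain \<sigma> where "geodesic_segment \<sigma> b (z n)" using CAT0_geodesic_exists[OF CAT0] by blast
    then obtain u where "dist (\<sigma> u) y \<le> K" using n by blast
    then show ?thesis using zero_le_dist order_trans by blast
  qed
  have close: "\<exists>n0. \<forall>n\<ge>n0. R \<le> dist b (z n) \<and> (\<forall>n'\<ge>n0. \<forall>\<sigma> \<sigma>'. geodesic_segment \<sigma> b (z n) \<longrightarrow>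
      geodesic_segment \<sigma>' b (z n') \<longrightarrow> (\<forall>t\<in>{0..R}. dist (\<sigma> t) (\<sigma>' t) < e))"
    if "R \<ge> 0" "e > 0" for R e
  proof -
    \<comment> \<open>At a time at least \<open>s\<close> the geodesics will be within 4K; scaling
      back to time \<open>R\<close> must leave less than \<open>e\<close>.\<close>
    define s where "s = R + 4 * K * R / e + 1"
    have s: "s > 0" "R \<le> s" "4 * K * R / e < s" using that K unfolding s_def by (auto simp: add_nonneg_pos)
    obtain y where y: "dist b y \<ge> s + K" and "\<forall>\<^sub>F n in sequentially.
       \<forall>\<sigma>. geodesic_segment \<sigma> b (z n) \<longrightarrow> (\<exists>u\<in>{0..dist b (z n)}. dist (\<sigma> u) y \<le> K)"
      using passes by blast
    then obtain n0 where n0: "\<And>n \<sigma>. n \<ge> n0 \<Longrightarrow> geodesic_segment \<sigma> b (z n) \<Longrightarrow>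
        \<exists>u\<in>{0..dist b (z n)}. dist (\<sigma> u) y \<le> K"
      unfolding eventually_sequentially by blast
    have u: "\<exists>u\<in>{s..dist b (z n)}. dist (\<sigma> u) y \<le> K"
      if "n \<ge> n0" "geodesic_segment \<sigma> b (z n)" for n \<sigma>
    proof -
      obtain u where u: "u \<in> {0..dist b (z n)}" "dist (\<sigma> u) y \<le> K" using n0 \<open>n \<ge> n0\<close> \<open>geodesic_segment \<sigma> b (z n)\<close> by blast
      have "u \<ge> s" using geodesic_segment_ends(1)[OF \<open>geodesic_segment \<sigma> b (z n)\<close> u(1)] y u(2)
        dist_triangle[of b y "\<sigma> u"] by linarith
      then show ?thesis using u by auto
    qed
    have far: "R \<le> dist b (z n)" if "n \<ge> n0" for n
      using u[OF that] CAT0_geodesic_exists[OF CAT0, of b "z n"] s by force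
    have "dist (\<sigma> t) (\<sigma>' t) < e"
      if nn: "n \<ge> n0" "n' \<ge> n0" and \<sigma>: "geodesic_segment \<sigma> b (z n)" "geodesic_segment \<sigma>' b (z n')"
        and t: "t \<in> {0..R}" for n n' \<sigma> \<sigma>' t
    proof -
      obtain v where v: "v \<in> {s..dist b (z n)}" "dist (\<sigma> v) y \<le> K" using u nn \<sigma> by blast
      obtain v' where v': "v' \<in> {s..dist b (z n')}" "dist (\<sigma>' v') y \<le> K" using u nn \<sigma> by blast
      \<comment> \<open>The times \<open>v\<close> and \<open>v'\<close> are distances from
        \<open>b\<close> to two points at most 2K apart, so they differ by at most 2K. Going back to
        their minimum therefore turns the gap 2K into at most 4K, now at a common time.\<close>
      define m where "m = min v v'"
      have m: "m \<ge> s" "m \<le> dist b (z n)" "m \<le> dist b (z n')" using v v' unfolding m_def by auto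
      have vv: "dist (\<sigma> v) (\<sigma>' v') \<le> 2 * K" using v v' dist_triangle2[of "\<sigma> v" "\<sigma>' v'" y] by linarith
      have "dist b (\<sigma> v) = v" "dist b (\<sigma>' v') = v'"
        using geodesic_segment_ends(1)[OF \<sigma>(1), of v] geodesic_segment_ends(1)[OF \<sigma>(2), of v'] v v' s by auto
      then have "\<bar>v - v'\<bar> \<le> 2 * K"
        using vv dist_triangle[of b "\<sigma> v" "\<sigma>' v'"] dist_triangle2[of b "\<sigma>' v'" "\<sigma> v"]
        by (simp add: dist_commute)
      moreover have "dist (\<sigma> m) (\<sigma> v) = v - m" "dist (\<sigma>' m) (\<sigma>' v') = v' - m"
        using geodesic_segment_dist[OF \<sigma>(1), of m v] geodesic_segment_dist[OF \<sigma>(2), of m v'] v v' s m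
        unfolding m_def by auto
      moreover have "(v - m) + (v' - m) = \<bar>v - v'\<bar>" unfolding m_def by auto
      moreover have "dist (\<sigma> m) (\<sigma>' m) \<le> dist (\<sigma> m) (\<sigma> v) + (dist (\<sigma> v) (\<sigma>' v') + dist (\<sigma>' m) (\<sigma>' v'))"
        using dist_triangle[of "\<sigma> m" "\<sigma>' m" "\<sigma> v"] dist_triangle2[of "\<sigma> v" "\<sigma>' m" "\<sigma>' v'"] by linarith
      ultimately have dm: "dist (\<sigma> m) (\<sigma>' m) \<le> 4 * K" using vv by linarith
      have "dist (\<sigma> t) (\<sigma>' t) \<le> t / m * dist (\<sigma> m) (\<sigma>' m)"
        by (rule CAT0_geodesics_convex[OF CAT0 \<sigma>]) (use m s t in auto)
      also have "\<dots> \<le> R / s * (4 * K)"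
        using t m s dm K by (intro mult_mono frac_le) auto
      also have "\<dots> < e" using s \<open>e > 0\<close> by (simp add: field_simps)
      finally show ?thesis .
    qed
    then show ?thesis using far by blast
  qed
  define \<sigma> where "\<sigma> n = (SOME \<sigma>. geodesic_segment \<sigma> b (z n))" for n
  have \<sigma>: "geodesic_segment (\<sigma> n) b (z n)" for n
    unfolding \<sigma>_def using CAT0_geodesic_exists[OF CAT0] by (rule someI_ex)
  define c where "c t = lim (\<lambda>n. \<sigma> n t)" for t
  have lim: "(\<lambda>n. \<sigma> n t) \<longlonglongrightarrow> c t" if "t \<ge> 0" for t
  proof -
    have "Cauchy (\<lambda>n. \<sigma> n t)"
    proof (rule metric_CauchyI)
      fix e :: real assume "0 < e"
      then obtain n0 where "\<forall>n\<ge>n0. \<forall>n'\<ge>n0. dist (\<sigma> n t) (\<sigma> n' t) < e"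
        using close[OF \<open>t \<ge> 0\<close>, of e] \<sigma> \<open>t \<ge> 0\<close> by (meson atLeastAtMost_iff order_refl)
      then show "\<exists>M. \<forall>m\<ge>M. \<forall>n\<ge>M. dist (\<sigma> m t) (\<sigma> n t) < e" by blast
    qed
    then show ?thesis unfolding c_def using Cauchy_convergent convergent_LIMSEQ_iff by blast
  qed
  have far: "\<forall>\<^sub>F n in sequentially. R \<le> dist b (z n)" if "R \<ge> 0" for R
    using close[OF that, of 1] unfolding eventually_sequentially by auto
  have ray: "geodesic_ray c"
    unfolding geodesic_ray_def isometric_embedding_on_def
  proof (intro ballI)
    fix s t :: real assume st: "s \<in> {0..}" "t \<in> {0..}"
    have "(\<lambda>n. dist (\<sigma> n s) (\<sigma> n t)) \<longlonglongrightarrow> dist (c s) (c t)"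
      using st by (intro tendsto_dist lim) auto
    moreover have "0 \<le> max s t" using st by auto
    from far[OF this] have "\<forall>\<^sub>F n in sequentially. dist (\<sigma> n s) (\<sigma> n t) = \<bar>s - t\<bar>"
      by eventually_elim (use st in \<open>auto intro: geodesic_segment_dist[OF \<sigma>]\<close>)
    then have "(\<lambda>n. dist (\<sigma> n s) (\<sigma> n t)) \<longlonglongrightarrow> \<bar>s - t\<bar>" by (rule tendsto_eventually)
    ultimately show "dist (c s) (c t) = \<bar>s - t\<bar>" by (rule LIMSEQ_unique)
  qed
  have c0: "c 0 = b"
    using lim[of 0] \<sigma> by (simp add: geodesic_segment_def LIMSEQ_const_iff)
  define \<xi> where "\<xi> = asymptotic `` {c}"
  have \<xi>: "\<xi> \<in> visual_boundary" unfolding \<xi>_def visual_boundary_def using ray by (auto intro: quotientI)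
  have "c \<in> \<xi>" unfolding \<xi>_def using equiv_class_self[OF equiv_asymptotic, of c] ray by auto
  then have from_c: "geodesic_from b (Ideal \<xi>) c" using ray c0 by simp
  have "limitin (cone_topology b) (\<lambda>n. Interior (z n)) (Ideal \<xi>) sequentially"
    unfolding limitin_def topspace_cone_topology openin_cone_topology
  proof (intro conjI allI impI)
    show "Ideal \<xi> \<in> bordification" using \<xi> by (auto simp: bordification_def)
    fix U assume U: "cone_open b U \<and> Ideal \<xi> \<in> U"
    then obtain R e where e: "e > 0" "cone_nhd b c R e \<subseteq> U"
      using from_c unfolding cone_open_def by blast
    \<comment> \<open>The radius from \<open>cone_open\<close> may be negative, hence the
      \<open>max\<close>. Passing to the limit gives only a weak inequality, hence
      \<open>e / 2\<close>.\<close>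
    have "0 \<le> max R 0" "0 < e / 2" using e by auto
    from close[OF this] obtain n0 where n0: "\<And>n n' \<sigma> \<sigma>' t. n \<ge> n0 \<Longrightarrow> n' \<ge> n0 \<Longrightarrow> geodesic_segment \<sigma> b (z n) \<Longrightarrow>
      geodesic_segment \<sigma>' b (z n') \<Longrightarrow> t \<in> {0..max R 0} \<Longrightarrow> dist (\<sigma> t) (\<sigma>' t) < e / 2"
      by blast
    have "Interior (z n) \<in> cone_nhd b c R e" if "n \<ge> n0" for n
    proof -
      have "dist (c t) (c' t) < e" if "geodesic_from b (Interior (z n)) c'" "t \<in> {0..R}" for c' t
      proof -
        have "dist (\<sigma> n' t) (c' t) \<le> e / 2" if "n' \<ge> n0" for n'
          using n0[of n' n "\<sigma> n'" c' t] \<open>n \<ge> n0\<close> \<sigma> that \<open>geodesic_from b (Interior (z n)) c'\<close> \<open>t \<in> {0..R}\<close> by force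
        then have "\<forall>\<^sub>F n' in sequentially. dist (\<sigma> n' t) (c' t) \<le> e / 2"
          unfolding eventually_sequentially by blast
        moreover have "(\<lambda>n'. dist (\<sigma> n' t) (c' t)) \<longlonglongrightarrow> dist (c t) (c' t)"
          using that by (intro tendsto_dist lim tendsto_const) auto
        ultimately have "dist (c t) (c' t) \<le> e / 2" by (intro tendsto_upperbound) auto
        then show ?thesis using e by simp
      qed
      then show ?thesis unfolding cone_nhd_def bordification_def by auto
    qed
    then show "\<forall>\<^sub>F n in sequentially. Interior (z n) \<in> U"
      using e unfolding eventually_sequentially by blast
  qed
  then show ?thesis using \<xi> by blast
qed

context contracting_in_geodesic_space
begin

text \<open>The segment passes near the line at parameter \<open>T y + 12 * C\<close>: after the
  slack 2C this is 10C beyond \<open>x\<close>, and 10C before \<open>z\<close>. The bound 27C +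
  \<rho> adds 15C, 12C and the distance of \<open>y\<close> from the line. The extra 1 makes
  successive gates recede.\<close>

lemma past_gate:
  assumes "T x \<le> T y + 2 * C" "D y \<le> \<rho>" "T y + 22 * C + \<rho> + 1 \<le> T z"
  shows "dist x y + 1 \<le> dist x z"
    and "geodesic_segment \<sigma> x z \<Longrightarrow> \<exists>u\<in>{0..dist x z}. dist (\<sigma> u) y \<le> 27 * C + \<rho>"
proof -
  have \<rho>: "\<rho> \<ge> 0" using assms line_dist_nonneg[of \<eta> y] by linarith
  have "dist x z \<ge> D x + D z + \<bar>T x - T z\<bar> - 14 * C"
    by (rule dist_ge_via_line) (use assms \<rho> C_pos in linarith)
  then show "dist x y + 1 \<le> dist x z"
    using dist_le_via_line[OF line, of x y] line_dist_nonneg[of \<eta> z] assms \<rho> C_pos by argo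
  assume \<sigma>: "geodesic_segment \<sigma> x z"
  have "T x + 10 * C \<le> T y + 12 * C" "T y + 12 * C + 10 * C \<le> T z" using assms \<rho> by linarith+
  then obtain u where u: "u \<in> {0..dist x z}" "dist (\<sigma> u) (\<eta> (T y + 12 * C)) \<le> 15 * C"
    using geodesic_passes_near[OF \<sigma>] by blast
  have "dist (\<eta> (T y + 12 * C)) (\<eta> (T y)) = 12 * C"
    using geodesic_line_dist[OF line] C_pos by simp
  then have "dist (\<sigma> u) y \<le> 27 * C + \<rho>"
    using u assms(2) dist_triangle[of "\<sigma> u" y "\<eta> (T y + 12 * C)"]
      dist_triangle2[of "\<eta> (T y + 12 * C)" y "\<eta> (T y)"] unfolding line_dist_def by linarith
  then show "\<exists>u\<in>{0..dist x z}. dist (\<sigma> u) y \<le> 27 * C + \<rho>" using u by blast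
qed

end

text \<open>The gates themselves serve as the far points \<open>y\<close> of
  \<open>converges_to_boundary\<close>, with one constant for all of them. The line may depend on
  the gate.\<close>

lemma infinitely_many_gates_imp_convergence:
  fixes z :: "nat \<Rightarrow> 'x::complete_space"
  assumes CAT0: "CAT0_space TYPE('x)"
    and gates: "\<exists>\<^sub>F m in sequentially. \<exists>\<eta>. contracting_geodesic C \<eta> \<and>
      proj_param \<eta> b \<le> proj_param \<eta> (z m) + 2 * C \<and> line_dist \<eta> (z m) \<le> \<rho> \<and>
      (\<forall>\<^sub>F n in sequentially. proj_param \<eta> (z m) + 22 * C + \<rho> + 1 \<le> proj_param \<eta> (z n))"
      (is "\<exists>\<^sub>F m in sequentially. ?gate m")
  shows "\<exists>\<xi>\<in>visual_boundary. limitin (cone_topology b) (\<lambda>n. Interior (z n)) (Ideal \<xi>) sequentially"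
proof (rule converges_to_boundary[OF CAT0])
  have gate: "\<forall>\<^sub>F n in sequentially. dist b (z m) + 1 \<le> dist b (z n) \<and>
      (\<forall>\<sigma>. geodesic_segment \<sigma> b (z n) \<longrightarrow> (\<exists>u\<in>{0..dist b (z n)}. dist (\<sigma> u) (z m) \<le> 27 * C + \<rho>))"
    if gm: "?gate m" for m
  proof -
    obtain \<eta> where \<eta>: "contracting_geodesic C \<eta>" "proj_param \<eta> b \<le> proj_param \<eta> (z m) + 2 * C"
      "line_dist \<eta> (z m) \<le> \<rho>"
      and ev: "\<forall>\<^sub>F n in sequentially. proj_param \<eta> (z m) + 22 * C + \<rho> + 1 \<le> proj_param \<eta> (z n)"
      using gm by blast
    interpret contracting_in_geodesic_space C \<eta>
      by unfold_locales (use \<eta> CAT0_geodesic_exists[OF CAT0] in auto)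
    show ?thesis using ev by eventually_elim (use past_gate[OF \<eta>(2,3)] in blast)
  qed
  \<comment> \<open>Each gate forces all late points, and so some later gate, to be at least 1
    farther from \<open>b\<close>.\<close>
  have far: "\<exists>m. ?gate m \<and> dist b (z m) \<ge> real k" for k
  proof (induction k)
    case 0
    show ?case using frequently_ex[OF gates] by auto
  next
    case (Suc k)
    then obtain m where m: "?gate m" "dist b (z m) \<ge> real k" by blast
    have "\<exists>\<^sub>F m' in sequentially. ?gate m' \<and> dist b (z m) + 1 \<le> dist b (z m')"
      using frequently_eventually_frequently[OF gates gate[OF m(1)]]
      by (rule frequently_elim1) blast
    then obtain m' where "?gate m'" "dist b (z m) + 1 \<le> dist b (z m')"
      using frequently_ex by blast
    then show ?case using m by (intro exI[of _ m']) auto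
  qed
  fix R :: real
  obtain k where "R \<le> real k" using real_arch_simple by blast
  then obtain m where "?gate m" "dist b (z m) \<ge> R" using far order_trans by blast
  then show "\<exists>y. dist b y \<ge> R \<and> (\<forall>\<^sub>F n in sequentially.
       \<forall>\<sigma>. geodesic_segment \<sigma> b (z n) \<longrightarrow> (\<exists>u\<in>{0..dist b (z n)}. dist (\<sigma> u) y \<le> 27 * C + \<rho>))"
    using gate[of m] by (intro exI[of _ "z m"]) (auto elim: eventually_mono)
qed

section \<open>Sequences of independent increments\<close>

context sequence_space
begin

text \<open>By \<open>PiM_comb_seq\<close>, replacing everything from coordinate \<open>m\<close> on
  by an independent sample preserves the law. With Fubini, the integrand is the conditional
  probability of \<open>A\<close> given the first \<open>m\<close> coordinates.\<close>

lemma prob_comb_seq: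
  assumes A: "A \<in> sets S"
  shows "measure S A = (\<integral>\<omega>. measure S {\<omega>' \<in> space S. comb_seq m \<omega> \<omega>' \<in> A} \<partial>S)"
    and "(\<lambda>\<omega>. measure S {\<omega>' \<in> space S. comb_seq m \<omega> \<omega>' \<in> A}) \<in> borel_measurable S"
proof -
  define B where "B = (\<lambda>(\<omega>, \<omega>'). comb_seq m \<omega> \<omega>') -` A \<inter> space (S \<Otimes>\<^sub>M S)"
  have B: "B \<in> sets (S \<Otimes>\<^sub>M S)"
    unfolding B_def using measurable_comb_seq A by (rule measurable_sets)
  have Pair: "Pair \<omega> -` B = {\<omega>' \<in> space S. comb_seq m \<omega> \<omega>' \<in> A}" if "\<omega> \<in> space S" for \<omega>
    using that by (auto simp: B_def space_pair_measure)
  have meas: "(\<lambda>\<omega>. measure S (Pair \<omega> -` B)) \<in> borel_measurable S"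
    unfolding measure_def using P.measurable_emeasure_Pair[OF B] by measurable
  then show m: "(\<lambda>\<omega>. measure S {\<omega>' \<in> space S. comb_seq m \<omega> \<omega>' \<in> A}) \<in> borel_measurable S"
    by (simp add: Pair cong: measurable_cong)
  have "emeasure S A = emeasure (distr (S \<Otimes>\<^sub>M S) S (\<lambda>(\<omega>, \<omega>'). comb_seq m \<omega> \<omega>')) A"
    by (simp add: PiM_comb_seq)
  also have "\<dots> = emeasure (S \<Otimes>\<^sub>M S) B"
    unfolding B_def using measurable_comb_seq A by (rule emeasure_distr)
  also have "\<dots> = (\<integral>\<^sup>+\<omega>. emeasure S (Pair \<omega> -` B) \<partial>S)"
    by (rule P.emeasure_pair_measure_alt[OF B])
  also have "\<dots> = (\<integral>\<^sup>+\<omega>. ennreal (measure S {\<omega>' \<in> space S. comb_seq m \<omega> \<omega>' \<in> A}) \<partial>S)"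
    by (intro nn_integral_cong) (simp add: Pair P.emeasure_eq_measure)
  also have "\<dots> = ennreal (\<integral>\<omega>. measure S {\<omega>' \<in> space S. comb_seq m \<omega> \<omega>' \<in> A} \<partial>S)"
    by (intro nn_integral_eq_integral P.integrable_const_bound[where B = 1] m) auto
  finally show "measure S A = (\<integral>\<omega>. measure S {\<omega>' \<in> space S. comb_seq m \<omega> \<omega>' \<in> A} \<partial>S)"
    by (simp add: P.emeasure_eq_measure)
qed

text \<open>Induction over the generated sigma-algebra. Dependence on the first \<open>m\<close>
  coordinates is encoded as insensitivity to resampling from any \<open>k \<ge> m\<close> on. A
  countable union is first cut to a finite one.\<close>

lemma approximation_by_cylinder:
  assumes "B \<in> sets S" and "e > 0"
  shows "\<exists>B'\<in>sets S. \<exists>m. (\<forall>k\<ge>m. \<forall>\<omega>\<in>space S. \<forall>\<omega>'\<in>space S. comb_seq k \<omega> \<omega>' \<in> B' \<longleftrightarrow> \<omega> \<in> B') \<and>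
           measure S ((B - B') \<union> (B' - B)) < e"
proof -
  have comb: "comb_seq k \<omega> \<omega>' \<in> space S" if "\<omega> \<in> space S" "\<omega>' \<in> space S" for k \<omega> \<omega>'
    using that by (auto simp: space_PiM PiE_iff split: split_comb_seq)
  have "B \<in> sigma_sets (\<Pi>\<^sub>E i\<in>UNIV. space M)
      {{f\<in>\<Pi>\<^sub>E i\<in>UNIV. space M. f i \<in> A} |i A. i \<in> (UNIV::nat set) \<and> A \<in> sets M}"
    using assms(1) by (simp add: sets_PiM_single)
  then show ?thesis using \<open>e > 0\<close>
  proof (induction arbitrary: e)
    case (Basic B)
    then obtain i A where B: "B = {f\<in>\<Pi>\<^sub>E i\<in>UNIV. space M. f i \<in> A}" and A: "A \<in> sets M" by blast
    have "B \<in> sets S" unfolding B sets_PiM_single using A by (intro sigma_sets.Basic) blast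
    moreover have "comb_seq k \<omega> \<omega>' \<in> B \<longleftrightarrow> \<omega> \<in> B"
      if "k \<ge> Suc i" "\<omega> \<in> space S" "\<omega>' \<in> space S" for k \<omega> \<omega>'
      using that comb[OF that(2,3), of k] unfolding B by (auto simp: space_PiM comb_seq_less)
    ultimately show ?case using Basic by (intro bexI[of _ B] exI[of _ "Suc i"]) auto
  next
    case Empty
    then show ?case by (intro bexI[of _ "{}"]) auto
  next
    case (Compl B)
    from Compl.IH[OF Compl.prems] obtain B' m where B': "B' \<in> sets S" "measure S ((B - B') \<union> (B' - B)) < e"
      "\<And>k \<omega> \<omega>'. k \<ge> m \<Longrightarrow> \<omega> \<in> space S \<Longrightarrow> \<omega>' \<in> space S \<Longrightarrow> comb_seq k \<omega> \<omega>' \<in> B' \<longleftrightarrow> \<omega> \<in> B'"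
      by blast
    have "B \<in> sets S" using Compl.hyps by (simp add: sets_PiM_single)
    then have "B \<subseteq> space S" "B' \<subseteq> space S" using B'(1) sets.sets_into_space by blast+
    then have eq: "((space S - B) - (space S - B')) \<union> ((space S - B') - (space S - B)) = (B - B') \<union> (B' - B)"
      by blast
    show ?case
      unfolding space_PiM[symmetric]
    proof (intro bexI[of _ "space S - B'"] exI[of _ m] conjI allI impI ballI)
      show "measure S (((space S - B) - (space S - B')) \<union> ((space S - B') - (space S - B))) < e"
        unfolding eq by (rule B'(2))
    qed (use B' comb in auto)
  next
    case (Union B)
    have Bs: "B i \<in> sets S" for i using Union.hyps by (simp add: sets_PiM_single)
    have "(\<lambda>n. measure S (\<Union>i<n. B i)) \<longlonglongrightarrow> measure S (\<Union>n. \<Union>i<n. B i)"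
      using Bs by (intro P.finite_Lim_measure_incseq) (auto simp: incseq_def intro: less_le_trans)
    moreover have "(\<Union>n. \<Union>i<n. B i) = (\<Union>i. B i)" by blast
    ultimately have "\<forall>\<^sub>F n in sequentially. measure S (\<Union>i<n. B i) > measure S (\<Union>i. B i) - e / 2"
      using Union.prems by (intro order_tendstoD) auto
    then obtain n where "measure S (\<Union>i<n. B i) > measure S (\<Union>i. B i) - e / 2"
      unfolding eventually_sequentially by blast
    then have n: "measure S (\<Union>i. B i) - measure S (\<Union>i<n. B i) < e / 2" by argo
    define cyl where "cyl B' m \<longleftrightarrow> (\<forall>k\<ge>m. \<forall>\<omega>\<in>space S. \<forall>\<omega>'\<in>space S. comb_seq k \<omega> \<omega>' \<in> B' \<longleftrightarrow> \<omega> \<in> B')"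
      for B' and m :: nat
    \<comment> \<open>Half of the error is spent on truncating the union, the other half is shared
      by its \<open>n\<close> members; \<open>n + 1\<close> avoids a division by zero.\<close>
    have "e / (2 * (real n + 1)) > 0" using Union.prems by simp
    from Union.IH[OF this] have "\<forall>i. \<exists>p. fst p \<in> sets S \<and> cyl (fst p) (snd p) \<and>
           measure S ((B i - fst p) \<union> (fst p - B i)) < e / (2 * (real n + 1))"
      unfolding cyl_def by (simp add: Bex_def)
    from choice[OF this] obtain p where p: "\<And>i. fst (p i) \<in> sets S \<and> cyl (fst (p i)) (snd (p i)) \<and>
           measure S ((B i - fst (p i)) \<union> (fst (p i) - B i)) < e / (2 * (real n + 1))"
      by blast
    define B' m where "B' i = fst (p i)" and "m i = snd (p i)" for i
    have B': "\<And>i. B' i \<in> sets S"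
      and cyl: "\<And>i k \<omega> \<omega>'. k \<ge> m i \<Longrightarrow> \<omega> \<in> space S \<Longrightarrow> \<omega>' \<in> space S \<Longrightarrow> comb_seq k \<omega> \<omega>' \<in> B' i \<longleftrightarrow> \<omega> \<in> B' i"
      and err: "\<And>i. measure S ((B i - B' i) \<union> (B' i - B i)) < e / (2 * (real n + 1))"
      using p unfolding B'_def m_def cyl_def by blast+
    let ?U = "\<Union>i. B i" and ?V = "\<Union>i<n. B i" and ?V' = "\<Union>i<n. B' i"
    let ?E = "\<lambda>i. (B i - B' i) \<union> (B' i - B i)"
    have "measure S ((?U - ?V') \<union> (?V' - ?U)) \<le> measure S ((?U - ?V) \<union> (\<Union>i<n. ?E i))"
      by (rule P.finite_measure_mono) (use Bs B' in auto)
    also have "\<dots> \<le> measure S (?U - ?V) + measure S (\<Union>i<n. ?E i)"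
      by (rule measure_Un_le) (use Bs B' in auto)
    finally have 1: "measure S ((?U - ?V') \<union> (?V' - ?U)) \<le> measure S (?U - ?V) + measure S (\<Union>i<n. ?E i)" .
    have 2: "measure S (?U - ?V) = measure S ?U - measure S ?V"
      by (rule P.finite_measure_Diff) (use Bs in auto)
    have "measure S (\<Union>i<n. ?E i) \<le> (\<Sum>i<n. measure S (?E i))"
      by (rule measure_UNION_le) (use Bs B' in auto)
    also have "\<dots> \<le> (\<Sum>i<n. e / (2 * (real n + 1)))"
      using err by (intro sum_mono less_imp_le) auto
    also have "\<dots> = e / 2 * (real n / (real n + 1))" by (simp add: field_simps)
    also have "\<dots> \<le> e / 2 * 1" using Union.prems by (intro mult_left_mono) auto
    finally have "measure S ((?U - ?V') \<union> (?V' - ?U)) < e" using n 1 2 by argo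
    moreover have "comb_seq k \<omega> \<omega>' \<in> ?V' \<longleftrightarrow> \<omega> \<in> ?V'"
      if "k \<ge> (\<Sum>i<n. m i)" "\<omega> \<in> space S" "\<omega>' \<in> space S" for k \<omega> \<omega>'
    proof -
      have "m i \<le> k" if "i < n" for i
        using member_le_sum[of i "{..<n}" m] that \<open>k \<ge> (\<Sum>i<n. m i)\<close> by auto
      then show ?thesis using cyl that by auto
    qed
    ultimately show ?case using B' by (intro bexI[of _ ?V'] exI[of _ "\<Sum>i<n. m i"] conjI allI impI ballI) blast+
  qed
qed

text \<open>
  A conditional Borel--Cantelli lemma: the event that no \<open>A m\<close> with \<open>m \<ge> m\<^sub>0\<close> occurs is almost
  a cylinder event, hence almost independent of the chance to realise a late \<open>A m\<close>.
\<close>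

lemma infinitely_often_if_conditional_prob_ge:
  assumes A: "\<And>m. A m \<in> sets S" and "\<delta> > 0"
    and cond: "\<And>m \<omega>. \<omega> \<in> space S \<Longrightarrow> \<delta> \<le> measure S {\<omega>' \<in> space S. comb_seq m \<omega> \<omega>' \<in> A m}"
  shows "AE \<omega> in S. \<exists>\<^sub>F m in sequentially. \<omega> \<in> A m"
proof -
  define B where "B n = {\<omega>\<in>space S. \<forall>m\<ge>n. \<omega> \<notin> A m}" for n
  have B: "B n \<in> sets S" for n
  proof -
    have "B n = space S - (\<Union>m\<in>{n..}. A m)" unfolding B_def by auto
    then show ?thesis using A by auto
  qed
  have small: "\<delta> * measure S (B n) \<le> (1 + \<delta>) * e" if "e > 0" for n e
  proof -
    obtain B' where B': "B' \<in> sets S"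
      and "\<exists>m. (\<forall>k\<ge>m. \<forall>\<omega>\<in>space S. \<forall>\<omega>'\<in>space S. comb_seq k \<omega> \<omega>' \<in> B' \<longleftrightarrow> \<omega> \<in> B') \<and>
           measure S ((B n - B') \<union> (B' - B n)) < e"
      using approximation_by_cylinder[OF B \<open>e > 0\<close>] by (rule bexE)
    from this(2) obtain m where m: "(\<forall>k\<ge>m. \<forall>\<omega>\<in>space S. \<forall>\<omega>'\<in>space S. comb_seq k \<omega> \<omega>' \<in> B' \<longleftrightarrow> \<omega> \<in> B') \<and>
           measure S ((B n - B') \<union> (B' - B n)) < e"
      by (rule exE)
    have err: "measure S ((B n - B') \<union> (B' - B n)) < e" using m by (rule conjunct2)
    have cyl: "comb_seq k \<omega> \<omega>' \<in> B' \<longleftrightarrow> \<omega> \<in> B'" if "k \<ge> m" "\<omega> \<in> space S" "\<omega>' \<in> space S" for k \<omega> \<omega>'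
      using m that by simp
    \<comment> \<open>With \<open>k \<ge> m\<close> the event \<open>B'\<close> is decided before
      time \<open>k\<close>; with \<open>k \<ge> n\<close> the event \<open>A k\<close> is disjoint
      from \<open>B n\<close>.\<close>
    define k where "k = max m n"
    have AB: "A k \<inter> B' \<in> sets S" using A B' by auto
    have "\<delta> * measure S B' = (\<integral>\<omega>. \<delta> * indicator B' \<omega> \<partial>S)"
      using B' sets.sets_into_space[OF B'] by (simp add: Int_absorb2)
    also have "\<dots> \<le> (\<integral>\<omega>. measure S {\<omega>' \<in> space S. comb_seq k \<omega> \<omega>' \<in> A k \<inter> B'} \<partial>S)"
    proof (rule integral_mono)
      show "integrable S (\<lambda>\<omega>. \<delta> * indicator B' \<omega>)"
        using B' by (intro integrable_mult_right integrable_real_indicator) (auto simp: P.emeasure_eq_measure)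
      show "integrable S (\<lambda>\<omega>. measure S {\<omega>' \<in> space S. comb_seq k \<omega> \<omega>' \<in> A k \<inter> B'})"
        by (intro P.integrable_const_bound[where B = 1] prob_comb_seq AB) auto
      fix \<omega> assume \<omega>: "\<omega> \<in> space S"
      show "\<delta> * indicator B' \<omega> \<le> measure S {\<omega>' \<in> space S. comb_seq k \<omega> \<omega>' \<in> A k \<inter> B'}"
      proof (cases "\<omega> \<in> B'")
        case True
        then have "{\<omega>' \<in> space S. comb_seq k \<omega> \<omega>' \<in> A k \<inter> B'} = {\<omega>' \<in> space S. comb_seq k \<omega> \<omega>' \<in> A k}"
          using cyl[of k \<omega>] \<omega> by (auto simp: k_def)
        then show ?thesis using cond[OF \<omega>, of k] True by simp
      qed simp
    qed
    also have "\<dots> = measure S (A k \<inter> B')" by (rule prob_comb_seq(1)[OF AB, symmetric])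
    \<comment> \<open>Since \<open>A k\<close> misses \<open>B n\<close>, the part of
      \<open>B'\<close> in \<open>A k\<close> lies in \<open>B' - B n\<close>.\<close>
    also have "\<dots> \<le> measure S ((B n - B') \<union> (B' - B n))"
      using A B B' by (intro P.finite_measure_mono) (auto simp: B_def k_def)
    finally have 1: "\<delta> * measure S B' \<le> e" using err by simp
    have "measure S (B n) \<le> measure S (B' \<union> ((B n - B') \<union> (B' - B n)))"
      using B B' by (intro P.finite_measure_mono) auto
    also have "\<dots> \<le> measure S B' + measure S ((B n - B') \<union> (B' - B n))"
      using B B' by (intro measure_Un_le) auto
    finally have "\<delta> * measure S (B n) \<le> \<delta> * (measure S B' + e)"
      using err \<open>\<delta> > 0\<close> by (intro mult_left_mono) auto
    then show ?thesis using 1 by (simp add: algebra_simps)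
  qed
  have "measure S (B n) = 0" for n
  proof (rule ccontr)
    assume "measure S (B n) \<noteq> 0"
    then have pos: "\<delta> * measure S (B n) > 0" using \<open>\<delta> > 0\<close> by (simp add: zero_less_measure_iff)
    have "\<delta> * measure S (B n) \<le> (1 + \<delta>) * (\<delta> * measure S (B n) / (2 * (1 + \<delta>)))"
      using pos \<open>\<delta> > 0\<close> by (intro small) auto
    also have "\<dots> = \<delta> * measure S (B n) / 2" using \<open>\<delta> > 0\<close> by (simp add: field_simps)
    finally show False using pos by simp
  qed
  then have "AE \<omega> in S. \<omega> \<notin> B n" for n
    using B by (intro AE_not_in) (auto simp: P.emeasure_eq_measure null_sets_def)
  then have "AE \<omega> in S. \<forall>n. \<omega> \<notin> B n" by (simp add: AE_all_countable)
  moreover have "AE \<omega> in S. \<omega> \<in> space S" by simp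
  ultimately show ?thesis
    by eventually_elim (auto simp: B_def frequently_sequentially)
qed

end

section \<open>The random walk and its mean occupation of half-spaces\<close>

locale isometric_random_walk = group G for G :: "('g, 'm) monoid_scheme" (structure) +
  fixes \<mu> :: "'g pmf" and \<phi> :: "'g \<Rightarrow> 'x::metric_space \<Rightarrow> 'x" and b :: 'x
  assumes countable_carrier: "countable (carrier G)"
    and support: "set_pmf \<mu> \<subseteq> carrier G"
    and admissible: "admissible G \<mu>"
    and action: "group_action G UNIV \<phi>"
    and isometric: "\<And>g x y. g \<in> carrier G \<Longrightarrow> dist (\<phi> g x) (\<phi> g y) = dist x y"
    and geodesic_ex: "\<And>x y :: 'x. \<exists>\<sigma>. geodesic_segment \<sigma> x y"
begin

sublocale path: sequence_space "measure_pmf \<mu>"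
  by unfold_locales

abbreviation "\<Omega> \<equiv> (\<Pi>\<^sub>M i\<in>(UNIV::nat set). measure_pmf \<mu>)"

lemma space_path [simp]: "space \<Omega> = UNIV"
  by (simp add: space_PiM)

lemma act_mult: "g \<in> carrier G \<Longrightarrow> h \<in> carrier G \<Longrightarrow> \<phi> (g \<otimes> h) x = \<phi> g (\<phi> h x)"
  using group_action.composition_rule[OF action] by simp

lemma act_one [simp]: "\<phi> \<one> x = x"
  using group_action.id_eq_one[OF action] by (metis UNIV_I restrict_apply')

lemma act_inv [simp]: "g \<in> carrier G \<Longrightarrow> \<phi> (inv g) (\<phi> g x) = x" "g \<in> carrier G \<Longrightarrow> \<phi> g (\<phi> (inv g) x) = x"
  using act_mult[of "inv g" g x] act_mult[of g "inv g" x] by auto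

lemma act_isometry: "g \<in> carrier G \<Longrightarrow> isometry (\<phi> g)"
  by unfold_locales (simp_all add: isometric surjI[of "\<phi> g" "\<phi> (inv g)"])

lemma proj_param_act: "g \<in> carrier G \<Longrightarrow> proj_param \<eta> (\<phi> g x) = proj_param (\<phi> (inv g) \<circ> \<eta>) x"
  using isometry.proj_param_comp[OF act_isometry, of "inv g" \<eta> "\<phi> g x"] by simp

lemma contracting_geodesic_act:
  "g \<in> carrier G \<Longrightarrow> contracting_geodesic C \<eta> \<Longrightarrow> contracting_geodesic C (\<phi> g \<circ> \<eta>)"
  using isometry.contracting_geodesic_comp[OF act_isometry] .

text \<open>
  Increments outside the carrier form a null event; truncating them makes the walk take values
  in a countable set, so that all its level sets are measurable.
\<close>

definition walk :: "(nat \<Rightarrow> 'g) \<Rightarrow> nat \<Rightarrow> 'g" where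
  "walk \<omega> n = random_walk G (\<lambda>i. if \<omega> i \<in> carrier G then \<omega> i else \<one>) n"

lemma walk_0 [simp]: "walk \<omega> 0 = \<one>"
  and walk_Suc: "walk \<omega> (Suc n) = walk \<omega> n \<otimes> (if \<omega> n \<in> carrier G then \<omega> n else \<one>)"
  by (simp_all add: walk_def)

lemma walk_in_carrier [simp]: "walk \<omega> n \<in> carrier G"
  by (induction n) (auto simp: walk_Suc)

lemma walk_eq_random_walk: "\<forall>i. \<omega> i \<in> carrier G \<Longrightarrow> walk \<omega> n = random_walk G \<omega> n"
  by (simp add: walk_def)

lemma walk_comb_seq_le: "n \<le> m \<Longrightarrow> walk (comb_seq m \<omega> \<omega>') n = walk \<omega> n"
  by (induction n) (auto simp: walk_Suc comb_seq_less)

text \<open>The Markov property, path by path: after time \<open>m\<close> an independent walk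
  starts afresh, multiplied on the left by the position reached.\<close>

lemma walk_comb_seq: "walk (comb_seq m \<omega> \<omega>') (n + m) = walk \<omega> m \<otimes> walk \<omega>' n"
proof (induction n)
  case (Suc n)
  then show ?case by (simp add: walk_Suc comb_seq_add m_assoc)
qed (simp add: walk_comb_seq_le)

lemma measurable_walk: "(\<lambda>\<omega>. walk \<omega> n) \<in> measurable \<Omega> (count_space (carrier G))"
proof (induction n)
  case (Suc n)
  have "(\<lambda>\<omega>. g \<otimes> (if \<omega> n \<in> carrier G then \<omega> n else \<one>)) \<in> measurable \<Omega> (count_space (carrier G))"
    if "g \<in> carrier G" for g
  proof (rule measurable_compose[where f = "\<lambda>\<omega>. \<omega> n" and N = "measure_pmf \<mu>"])
    show "(\<lambda>\<omega>. \<omega> n) \<in> measurable \<Omega> (measure_pmf \<mu>)" by (rule measurable_component_singleton) simp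
  qed (use that in \<open>simp add: measurable_pmf_measure1\<close>)
  then show ?case
    unfolding walk_Suc using Suc countable_carrier by (rule measurable_compose_countable')
qed simp

lemma walk_event [simp, intro]: "{\<omega>. Q (walk \<omega> n)} \<in> sets \<Omega>"
proof -
  have "(\<lambda>\<omega>. walk \<omega> n) -` {g \<in> carrier G. Q g} \<inter> space \<Omega> \<in> sets \<Omega>"
    using measurable_walk by (rule measurable_sets) auto
  then show ?thesis by (simp add: vimage_def)
qed

lemma walk_event_all [intro]: "{\<omega>. \<forall>i\<le>n. Q i (walk \<omega> i)} \<in> sets \<Omega>"
proof -
  have "{\<omega>. \<forall>i\<le>n. Q i (walk \<omega> i)} = (\<Inter>i\<in>{..n}. {\<omega>. Q i (walk \<omega> i)})" by auto
  then show ?thesis by auto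
qed

lemma walk_event_eventually [intro]: "{\<omega>. \<forall>\<^sub>F n in sequentially. Q n (walk \<omega> n)} \<in> sets \<Omega>"
proof -
  have "{\<omega>. \<forall>\<^sub>F n in sequentially. Q n (walk \<omega> n)} = (\<Union>N. \<Inter>n. {\<omega>. N \<le> n \<longrightarrow> Q n (walk \<omega> n)})"
    by (auto simp: eventually_sequentially)
  moreover have "{\<omega>. N \<le> n \<longrightarrow> Q n (walk \<omega> n)} \<in> sets \<Omega>" for N n
    by (rule walk_event)
  ultimately show ?thesis by auto
qed

lemma measurable_fun_walk [simp, intro]: "(\<lambda>\<omega>. F (walk \<omega> n) :: real) \<in> borel_measurable \<Omega>"
  by (rule measurable_compose[OF measurable_walk]) simp

lemma integrable_fun_walk:
  assumes "\<And>g. g \<in> carrier G \<Longrightarrow> \<bar>F g\<bar> \<le> (B::real)"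
  shows "integrable \<Omega> (\<lambda>\<omega>. F (walk \<omega> n))"
  using assms by (intro path.P.integrable_const_bound[where B = B]) auto

lemma prob_split:
  assumes "{\<omega>. Q \<omega>} \<in> sets \<Omega>"
  shows "measure \<Omega> {\<omega>. Q \<omega>} = (\<integral>\<omega>. measure \<Omega> {\<omega>'. Q (comb_seq m \<omega> \<omega>')} \<partial>\<Omega>)"
  using path.prob_comb_seq(1)[OF assms, of m] by simp

lemma walk_prob_split:
  "measure \<Omega> {\<omega>. Q (walk \<omega> (n + m))} = (\<integral>\<omega>. measure \<Omega> {\<omega>'. Q (walk \<omega> m \<otimes> walk \<omega>' n)} \<partial>\<Omega>)"
  by (subst prob_split[where m = m]) (auto simp: walk_comb_seq)

lemma prob_walk_mult_ge:
  assumes "g \<in> carrier G" "h \<in> carrier G"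
  shows "measure \<Omega> {\<omega>. walk \<omega> (n + m) = g \<otimes> h} \<ge> measure \<Omega> {\<omega>. walk \<omega> m = g} * measure \<Omega> {\<omega>. walk \<omega> n = h}"
proof -
  let ?p = "measure \<Omega> {\<omega>. walk \<omega> n = h}"
  have "measure \<Omega> {\<omega>. walk \<omega> m = g} * ?p = (\<integral>\<omega>. indicator {\<omega>. walk \<omega> m = g} \<omega> * ?p \<partial>\<Omega>)"
    by simp
  also have "\<dots> \<le> (\<integral>\<omega>. measure \<Omega> {\<omega>'. walk \<omega> m \<otimes> walk \<omega>' n = g \<otimes> h} \<partial>\<Omega>)"
  proof (rule integral_mono)
    show "integrable \<Omega> (\<lambda>\<omega>. indicator {\<omega>. walk \<omega> m = g} \<omega> * ?p)"
      by (intro integrable_mult_left integrable_real_indicator) (auto simp: path.P.emeasure_eq_measure)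
    show "integrable \<Omega> (\<lambda>\<omega>. measure \<Omega> {\<omega>'. walk \<omega> m \<otimes> walk \<omega>' n = g \<otimes> h})"
      by (rule integrable_fun_walk[where B = 1]) simp
  qed (use assms in \<open>auto simp: indicator_def\<close>)
  also have "\<dots> = measure \<Omega> {\<omega>. walk \<omega> (n + m) = g \<otimes> h}" by (rule walk_prob_split[symmetric])
  finally show ?thesis .
qed

text \<open>The time varies with \<open>g\<close>: elements of the support are reached in one step,
  and times add under products.\<close>

lemma prob_walk_eq_pos:
  assumes "g \<in> carrier G" shows "\<exists>n. measure \<Omega> {\<omega>. walk \<omega> n = g} > 0"
proof -
  have "g \<in> semigroup_generated G (set_pmf \<mu>)" using assms admissible by (simp add: admissible_def)
  then show ?thesis
  proof induction
    case (incl g)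
    have "0 < pmf \<mu> g" using incl by (simp add: pmf_positive)
    also have "pmf \<mu> g = measure (distr \<Omega> (measure_pmf \<mu>) (\<lambda>\<omega>. \<omega> 0)) {g}"
      by (subst path.PiM_component) (auto simp: measure_pmf_single)
    also have "\<dots> = measure \<Omega> {\<omega>. \<omega> 0 = g}"
      by (subst measure_distr) (auto simp: vimage_def intro!: measurable_component_singleton)
    also have "\<dots> \<le> measure \<Omega> {\<omega>. walk \<omega> (Suc 0) = g}"
      using incl support by (intro path.P.finite_measure_mono walk_event) (auto simp: walk_Suc)
    finally show ?case by blast
  next
    case (mult g h)
    then obtain m n where mn: "measure \<Omega> {\<omega>. walk \<omega> m = g} > 0" "measure \<Omega> {\<omega>. walk \<omega> n = h} > 0"
      by blast
    have "g \<in> carrier G" "h \<in> carrier G" using mult.hyps admissible by (auto simp: admissible_def)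
    then have "0 < measure \<Omega> {\<omega>. walk \<omega> (n + m) = g \<otimes> h}"
      using prob_walk_mult_ge[of g h m n] mult_pos_pos[OF mn] by linarith
    then show ?case by blast
  qed
qed

text \<open>The p_N of the overview, a half-space being given by its line and threshold. For
  \<open>N = 0\<close> the value is 0 by division by zero.\<close>

definition half_space_avg :: "nat \<Rightarrow> (real \<Rightarrow> 'x) \<Rightarrow> real \<Rightarrow> real" where
  "half_space_avg N \<eta> s = (\<Sum>i<N. measure \<Omega> {\<omega>. s \<le> proj_param \<eta> (\<phi> (walk \<omega> i) b)}) / real N"

lemma half_space_avg_nonneg: "half_space_avg N \<eta> s \<ge> 0"
  unfolding half_space_avg_def by (intro divide_nonneg_nonneg sum_nonneg) auto

lemma half_space_avg_le_1: "half_space_avg N \<eta> s \<le> 1"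
proof -
  have "(\<Sum>i<N. measure \<Omega> {\<omega>. s \<le> proj_param \<eta> (\<phi> (walk \<omega> i) b)}) \<le> (\<Sum>i<N. 1)"
    by (intro sum_mono) auto
  then show ?thesis unfolding half_space_avg_def by (cases "N = 0") (auto simp: divide_le_eq_1)
qed

text \<open>Moving the averaging window by \<open>k\<close> steps costs at most \<open>k\<close>
  terms. Conditioning the shifted terms on the first \<open>k\<close> increments translates the line
  by the inverse of the position reached.\<close>

lemma half_space_avg_le_shift:
  assumes "N > 0"
  shows "half_space_avg N \<eta> s \<le> k / N + (\<integral>\<omega>. half_space_avg N (\<phi> (inv (walk \<omega> k)) \<circ> \<eta>) s \<partial>\<Omega>)"
proof -
  define a where "a i = measure \<Omega> {\<omega>. s \<le> proj_param \<eta> (\<phi> (walk \<omega> i) b)}" for i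
  define c where "c i g = measure \<Omega> {\<omega>. s \<le> proj_param (\<phi> (inv g) \<circ> \<eta>) (\<phi> (walk \<omega> i) b)}" for i g
  have a: "0 \<le> a i" "a i \<le> 1" for i by (auto simp: a_def)
  have shift: "a (i + k) = (\<integral>\<omega>. c i (walk \<omega> k) \<partial>\<Omega>)" for i
    unfolding a_def c_def
    by (subst walk_prob_split) (simp add: act_mult proj_param_act)
  have "(\<Sum>i<N. a i) \<le> (\<Sum>i<k + N. a i)" using a by (intro sum_mono2) auto
  also have "\<dots> = (\<Sum>i<k. a i) + (\<Sum>i<N. a (i + k))"
    by (induction N) (auto simp: add.commute)
  also have "\<dots> \<le> real k + (\<Sum>i<N. a (i + k))"
    using sum_mono[of "{..<k}" a "\<lambda>_. 1"] a by simp
  also have "(\<Sum>i<N. a (i + k)) = (\<integral>\<omega>. (\<Sum>i<N. c i (walk \<omega> k)) \<partial>\<Omega>)"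
    unfolding shift by (rule Bochner_Integration.integral_sum[symmetric])
      (rule integrable_fun_walk[where B = 1], simp add: c_def)
  finally have "(\<Sum>i<N. a i) / N \<le> (real k + (\<integral>\<omega>. (\<Sum>i<N. c i (walk \<omega> k)) \<partial>\<Omega>)) / N"
    by (intro divide_right_mono) auto
  then show ?thesis unfolding half_space_avg_def a_def c_def by (simp add: add_divide_distrib)
qed

lemma half_space_avg_disjoint:
  assumes "finite J" and h: "\<And>j. j \<in> J \<Longrightarrow> h j \<in> carrier G"
    and disj: "\<And>i j. i \<in> J \<Longrightarrow> j \<in> J \<Longrightarrow> i \<noteq> j \<Longrightarrow>
      \<phi> (h i) ` {x. s \<le> proj_param \<eta> x} \<inter> \<phi> (h j) ` {x. s \<le> proj_param \<eta> x} = {}"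
  shows "(\<Sum>j\<in>J. half_space_avg N (\<phi> (h j) \<circ> \<eta>) s) \<le> 1"
proof -
  define A where "A i j = {\<omega>. s \<le> proj_param (\<phi> (h j) \<circ> \<eta>) (\<phi> (walk \<omega> i) b)}" for i j
  have A: "\<phi> (walk \<omega> i) b \<in> \<phi> (h j) ` {x. s \<le> proj_param \<eta> x}" if "\<omega> \<in> A i j" "j \<in> J" for \<omega> i j
  proof -
    have "s \<le> proj_param \<eta> (\<phi> (inv (h j)) (\<phi> (walk \<omega> i) b))"
      using that h by (simp add: A_def proj_param_act)
    then show ?thesis using h that by (intro image_eqI[of _ _ "\<phi> (inv (h j)) (\<phi> (walk \<omega> i) b)"]) auto
  qed
  have "(\<Sum>j\<in>J. half_space_avg N (\<phi> (h j) \<circ> \<eta>) s) = (\<Sum>i<N. \<Sum>j\<in>J. measure \<Omega> (A i j)) / N"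
    unfolding half_space_avg_def A_def by (subst sum.swap) (simp add: sum_divide_distrib)
  also have "\<dots> = (\<Sum>i<N. measure \<Omega> (\<Union>j\<in>J. A i j)) / N"
  proof (intro arg_cong2[where f = "(/)"] sum.cong refl)
    fix i
    have A_event: "A i ` J \<subseteq> sets \<Omega>" unfolding A_def by auto
    have "disjoint_family_on (A i) J"
      unfolding disjoint_family_on_def using A[of _ i] disj by blast
    then show "(\<Sum>j\<in>J. measure \<Omega> (A i j)) = measure \<Omega> (\<Union>j\<in>J. A i j)"
      using \<open>finite J\<close> by (intro path.P.finite_measure_finite_Union[symmetric] A_event)
  qed
  also have "\<dots> \<le> (\<Sum>i<N. 1) / N" by (intro divide_right_mono sum_mono) auto
  also have "\<dots> \<le> 1" by (simp add: divide_le_eq_1)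
  finally show ?thesis .
qed

end

section \<open>Deep half-spaces have small mass\<close>

text \<open>The number \<open>l\<close> is the infimum of the suprema, a limit superior: it is
  almost attained in every set and hardly exceeded in a late one.\<close>

lemma decreasing_sets_limit_of_suprema:
  fixes V :: "nat \<Rightarrow> real set"
  assumes ne: "\<And>n. V n \<noteq> {}" and bdd: "\<And>n. V n \<subseteq> {0..1}" and dec: "\<And>m n. m \<le> n \<Longrightarrow> V n \<subseteq> V m"
  obtains l where "0 \<le> l" "\<And>e. e > 0 \<Longrightarrow> \<exists>n. \<forall>p\<in>V n. p < l + e" "\<And>e n. e > 0 \<Longrightarrow> \<exists>p\<in>V n. l - e < p"
proof -
  have bdd': "bdd_above (V n)" for n using bdd[of n] by (meson bdd_above_Icc bdd_above_mono)
  have Sup: "0 \<le> Sup (V n)" for n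
  proof -
    obtain p where p: "p \<in> V n" using ne by blast
    then have "0 \<le> p" using bdd[of n] by auto
    also have "p \<le> Sup (V n)" using p bdd' by (rule cSup_upper)
    finally show ?thesis .
  qed
  define l where "l = (INF n. Sup (V n))"
  have bb: "bdd_below (range (\<lambda>n. Sup (V n)))" using Sup by (intro bdd_belowI[of _ 0]) auto
  show thesis
  proof (rule that[of l])
    show "0 \<le> l" unfolding l_def using Sup by (intro cINF_greatest) auto
    fix e :: real assume e: "e > 0"
    have "\<exists>n. Sup (V n) < l + e"
      using e bb cINF_less_iff[of UNIV "\<lambda>n. Sup (V n)" "l + e"] unfolding l_def by auto
    then show "\<exists>n. \<forall>p\<in>V n. p < l + e" using bdd' cSup_upper le_less_trans by metis
    fix n
    have "l - e < Sup (V n)" using cINF_lower[OF bb, of n] e unfolding l_def by simp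
    then show "\<exists>p\<in>V n. l - e < p" using less_cSup_iff[OF ne bdd'] by blast
  qed
qed

context isometric_random_walk
begin

section \<open>Translations along an axis\<close>

lemma axis_nat_pow:
  fixes \<gamma> :: "real \<Rightarrow> 'x"
  assumes "g \<in> carrier G" "\<forall>t. \<phi> g (\<gamma> t) = \<gamma> (t + \<tau>)"
  shows "\<phi> (g [^] (n::nat)) (\<gamma> t) = \<gamma> (t + n * \<tau>)"
proof (induction n arbitrary: t)
  case (Suc n)
  then show ?case using assms by (simp add: act_mult algebra_simps)
qed simp

lemma axis_int_pow:
  fixes \<gamma> :: "real \<Rightarrow> 'x"
  assumes "g \<in> carrier G" "\<forall>t. \<phi> g (\<gamma> t) = \<gamma> (t + \<tau>)"
  shows "\<phi> (g [^] (m::int)) (\<gamma> t) = \<gamma> (t + m * \<tau>)"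
proof (cases "m \<ge> 0")
  case True
  then show ?thesis using axis_nat_pow[OF assms, of "nat m" t] by (simp add: pow_nat)
next
  case False
  let ?h = "g [^] nat (- m)"
  have "\<phi> ?h (\<gamma> (t + m * \<tau>)) = \<gamma> t"
    using axis_nat_pow[OF assms, of "nat (- m)" "t + m * \<tau>"] False by simp
  then have "\<phi> (inv ?h) (\<gamma> t) = \<phi> (inv ?h) (\<phi> ?h (\<gamma> (t + m * \<tau>)))" by (rule arg_cong[OF sym])
  also have "\<dots> = \<gamma> (t + m * \<tau>)" using assms(1) by (intro act_inv(1) nat_pow_closed)
  finally have "\<phi> (inv ?h) (\<gamma> t) = \<gamma> (t + m * \<tau>)" .
  moreover have "g [^] m = inv ?h"
    using False by (simp only: int_pow_def2 not_le if_True)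
  ultimately show ?thesis by (simp only:)
qed

text \<open>The shifted nearest parameter is a nearest parameter of the image point; only the choice
  of it costs \<open>C\<close>.\<close>

lemma proj_axis_pow:
  assumes \<gamma>: "contracting_geodesic C \<gamma>" and g: "g \<in> carrier G" "\<forall>t. \<phi> g (\<gamma> t) = \<gamma> (t + \<tau>)"
  shows "\<bar>proj_param \<gamma> (\<phi> (g [^] (m::int)) x) - (proj_param \<gamma> x + m * \<tau>)\<bar> \<le> C"
proof -
  interpret contracting C \<gamma> using \<gamma> by unfold_locales
  let ?h = "g [^] m" and ?t = "proj_param \<gamma> x"
  interpret h: isometry "\<phi> ?h" using act_isometry g by simp
  have "nearest_param \<gamma> x ?t" by (rule nearest_param_proj_param[OF line])
  then have "nearest_param (\<phi> ?h \<circ> \<gamma>) (\<phi> ?h x) ?t" by (simp add: h.nearest_param_comp)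
  then have n: "dist (\<phi> ?h x) (\<gamma> (?t + m * \<tau>)) \<le> dist (\<phi> ?h x) (\<gamma> (s + m * \<tau>))" for s
    unfolding nearest_param_def by (simp add: axis_int_pow[OF g])
  have "nearest_param \<gamma> (\<phi> ?h x) (?t + m * \<tau>)"
    unfolding nearest_param_def
  proof
    fix s show "dist (\<phi> ?h x) (\<gamma> (?t + m * \<tau>)) \<le> dist (\<phi> ?h x) (\<gamma> s)"
      using n[of "s - m * \<tau>"] by simp
  qed
  then show ?thesis using nearest_param_unique by fastforce
qed

text \<open>One sequence \<open>h\<close> serves all sets \<open>H\<close> of small projection. This
  order of quantifiers lets the translating elements be fixed before the half-space.\<close>

lemma disjoint_translates_along_axis:
  assumes \<gamma>: "contracting_geodesic C \<gamma>" and g: "g \<in> carrier G" "\<forall>t. \<phi> g (\<gamma> t) = \<gamma> (t + \<tau>)" and "\<tau> \<noteq> 0"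
  shows "\<exists>h. (\<forall>j::nat. h j \<in> carrier G) \<and>
    (\<forall>H. (\<forall>x\<in>H. \<forall>y\<in>H. \<bar>proj_param \<gamma> x - proj_param \<gamma> y\<bar> \<le> 20 * C) \<longrightarrow>
      (\<forall>i j. i \<noteq> j \<longrightarrow> \<phi> (h i) ` H \<inter> \<phi> (h j) ` H = {}))"
proof -
  \<comment> \<open>A translation longer than 22C exceeds the projection width 20C plus an error
    \<open>C\<close> at each of two projections.\<close>
  obtain K :: nat where "22 * C / \<bar>\<tau>\<bar> < real K" using reals_Archimedean2 by blast
  then have K: "22 * C < K * \<bar>\<tau>\<bar>" using \<open>\<tau> \<noteq> 0\<close> by (simp add: field_simps)
  define h where "h j = g [^] int (K * j)" for j
  have h: "h j \<in> carrier G" for j unfolding h_def using g by simp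
  moreover have "\<phi> (h i) ` H \<inter> \<phi> (h j) ` H = {}"
    if H: "\<forall>x\<in>H. \<forall>y\<in>H. \<bar>proj_param \<gamma> x - proj_param \<gamma> y\<bar> \<le> 20 * C" and ij: "i \<noteq> j" for H i j
  proof (rule ccontr)
    assume "\<phi> (h i) ` H \<inter> \<phi> (h j) ` H \<noteq> {}"
    then obtain x y where xy: "x \<in> H" "y \<in> H" "\<phi> (h i) x = \<phi> (h j) y" by auto
    let ?z = "proj_param \<gamma> (\<phi> (h i) x)"
    have "\<bar>?z - (proj_param \<gamma> x + int (K * i) * \<tau>)\<bar> \<le> C" "\<bar>?z - (proj_param \<gamma> y + int (K * j) * \<tau>)\<bar> \<le> C"
      using proj_axis_pow[OF \<gamma> g, of "int (K * i)" x] proj_axis_pow[OF \<gamma> g, of "int (K * j)" y] xy(3)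
      unfolding h_def by simp_all
    then have "\<bar>int (K * i) * \<tau> - int (K * j) * \<tau>\<bar> \<le> 22 * C" using H xy by (smt (verit))
    moreover have "int (K * i) * \<tau> - int (K * j) * \<tau> = K * \<tau> * (real i - real j)"
      by (simp add: algebra_simps)
    moreover have "\<bar>K * \<tau> * (real i - real j)\<bar> = K * \<bar>\<tau>\<bar> * \<bar>real i - real j\<bar>"
      by (simp add: abs_mult)
    moreover have "K * \<bar>\<tau>\<bar> * 1 \<le> K * \<bar>\<tau>\<bar> * \<bar>real i - real j\<bar>"
      using ij by (intro mult_left_mono) (auto simp: abs_if)
    ultimately show False using K by simp
  qed
  ultimately show ?thesis by blast
qed

text \<open>
  Deep half-spaces of almost maximal mass: by approximate stationarity the mass of \<open>H\<close> is an
  average of masses of translates, none of which is much larger than the limiting supremum \<open>l\<close>,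
  so every translate by a fixed group element has almost maximal mass as well.
\<close>

lemma half_space_avg_translate:
  assumes h: "h \<in> carrier G" and "e > 0" and "l \<ge> 0"
    and upper: "\<And>e. e > 0 \<Longrightarrow> \<exists>n. \<forall>N \<eta> s. n \<le> N \<longrightarrow> 0 < N \<longrightarrow> contracting_geodesic C \<eta> \<longrightarrow>
      proj_param \<eta> b + real n \<le> s \<longrightarrow> half_space_avg N \<eta> s < l + e"
  shows "\<exists>d>0. \<exists>n. \<forall>N \<eta> s. n \<le> N \<longrightarrow> 0 < N \<longrightarrow> contracting_geodesic C \<eta> \<longrightarrow>
      proj_param \<eta> b + real n \<le> s \<longrightarrow> l - d < half_space_avg N \<eta> s \<longrightarrow>
      l - e < half_space_avg N (\<phi> h \<circ> \<eta>) s"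
proof -
  \<comment> \<open>At time \<open>k\<close> the walk sits at \<open>inv h\<close> with positive
    probability \<open>w\<close>, so the translate by \<open>h\<close> enters the shifted average
    with weight \<open>w\<close>.\<close>
  obtain k where "measure \<Omega> {\<omega>. walk \<omega> k = inv h} > 0" using prob_walk_eq_pos[of "inv h"] h by auto
  define w where "w = measure \<Omega> {\<omega>. walk \<omega> k = inv h}"
  have w: "w > 0" unfolding w_def by fact
  \<comment> \<open>Four errors of size \<open>d\<close> occur: the lower bound on the given mass,
    the upper bound on other translates, the far event, and the shift \<open>k / N\<close>. Together
    they are \<open>w * e / 2\<close>.\<close>
  define d where "d = w * e / 8"
  have d: "d > 0" unfolding d_def using w \<open>e > 0\<close> by simp
  obtain n1 where n1: "\<And>N \<eta> s. n1 \<le> N \<Longrightarrow> 0 < N \<Longrightarrow> contracting_geodesic C \<eta> \<Longrightarrow>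
      proj_param \<eta> b + real n1 \<le> s \<Longrightarrow> half_space_avg N \<eta> s < l + d"
    using upper[OF d] by blast
  \<comment> \<open>On \<open>F R\<close> the walk may carry \<open>b\<close> far enough to make a
    translate shallow, and only the trivial bound 1 is available. Off \<open>F R\<close> the depth
    lost is at most \<open>C + 3 * real R\<close>, which \<open>n2\<close> absorbs.\<close>
  define F where "F R = {\<omega>. dist b (\<phi> (walk \<omega> k) b) > real R}" for R :: nat
  have "(\<lambda>R. measure \<Omega> (F R)) \<longlonglongrightarrow> measure \<Omega> (\<Inter>R. F R)"
    by (rule path.P.finite_Lim_measure_decseq) (auto simp: F_def decseq_def)
  moreover have "(\<Inter>R. F R) = {}"
  proof -
    have "\<exists>R::nat. \<not> real R < dist b (\<phi> (walk \<omega> k) b)" for \<omega>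
      using real_arch_simple[of "dist b (\<phi> (walk \<omega> k) b)"] by (simp add: not_less)
    then show ?thesis unfolding F_def by blast
  qed
  ultimately have "\<forall>\<^sub>F R in sequentially. measure \<Omega> (F R) < d"
    using d by (intro order_tendstoD) auto
  then obtain R where R: "measure \<Omega> (F R) < d" unfolding eventually_sequentially by blast
  obtain n2 :: nat where n2: "C + 3 * real R \<le> real n2" using real_arch_simple by blast
  obtain n3 :: nat where n3: "k / d < real n3" using reals_Archimedean2 by blast
  define n where "n = n1 + n2 + n3"
  have "l - e < half_space_avg N (\<phi> h \<circ> \<eta>) s"
    if N: "n \<le> N" "0 < N" and \<eta>: "contracting_geodesic C \<eta>" and s: "proj_param \<eta> b + real n \<le> s"
      and big: "l - d < half_space_avg N \<eta> s" for N \<eta> s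
  proof -
    interpret \<eta>: contracting C \<eta> using \<eta> by unfold_locales
    let ?p = "half_space_avg N (\<phi> h \<circ> \<eta>) s"
    define avg where "avg g = half_space_avg N (\<phi> (inv g) \<circ> \<eta>) s" for g
    define far where "far g = (if dist b (\<phi> g b) > real R then 1 else 0 :: real)" for g
    define eq where "eq g = (if g = inv h then 1 else 0 :: real)" for g
    have bound: "avg g \<le> (l + d) + far g + eq g * (?p - (l + d))" if g: "g \<in> carrier G" for g
    proof -
      consider "g = inv h" | "g \<noteq> inv h" "dist b (\<phi> g b) > real R" | "g \<noteq> inv h" "dist b (\<phi> g b) \<le> real R"
        by linarith
      then show ?thesis
      proof cases
        case 1
        then show ?thesis using h by (simp add: avg_def far_def eq_def)
      next
        case 2
        then show ?thesis using half_space_avg_le_1[of N "\<phi> (inv g) \<circ> \<eta>" s] \<open>l \<ge> 0\<close> d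
          by (simp add: avg_def far_def eq_def)
      next
        case 3
        have "proj_param (\<phi> (inv g) \<circ> \<eta>) b \<le> proj_param \<eta> b + C + 3 * real R"
          using \<eta>.proj_lipschitz[of b "\<phi> g b"] 3 g by (simp add: proj_param_act)
        then have "avg g < l + d"
          unfolding avg_def using s n2 N g \<eta>
          by (intro n1 contracting_geodesic_act) (auto simp: n_def)
        then show ?thesis using 3 by (simp add: far_def eq_def)
      qed
    qed
    have "half_space_avg N \<eta> s \<le> k / N + (\<integral>\<omega>. avg (walk \<omega> k) \<partial>\<Omega>)"
      unfolding avg_def by (rule half_space_avg_le_shift) (use N in auto)
    moreover have "(\<integral>\<omega>. avg (walk \<omega> k) \<partial>\<Omega>) \<le>
        (\<integral>\<omega>. (l + d) + far (walk \<omega> k) + eq (walk \<omega> k) * (?p - (l + d)) \<partial>\<Omega>)"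
    proof (rule integral_mono)
      show "integrable \<Omega> (\<lambda>\<omega>. avg (walk \<omega> k))"
        unfolding avg_def using half_space_avg_nonneg half_space_avg_le_1
        by (intro integrable_fun_walk[where B = 1]) auto
      show "integrable \<Omega> (\<lambda>\<omega>. (l + d) + far (walk \<omega> k) + eq (walk \<omega> k) * (?p - (l + d)))"
      proof -
        have "integrable \<Omega> (\<lambda>\<omega>. far (walk \<omega> k))" "integrable \<Omega> (\<lambda>\<omega>. eq (walk \<omega> k))"
          by (rule integrable_fun_walk[where B = 1]; simp add: far_def eq_def)+
        then show ?thesis
          by (intro Bochner_Integration.integrable_add integrable_mult_left path.P.integrable_const)
      qed
    qed (use bound in auto)
    moreover have "(\<integral>\<omega>. (l + d) + far (walk \<omega> k) + eq (walk \<omega> k) * (?p - (l + d)) \<partial>\<Omega>) =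
        (l + d) + measure \<Omega> (F R) + w * (?p - (l + d))"
    proof -
      have "far (walk \<omega> k) = indicator (F R) \<omega>" for \<omega> by (simp add: far_def F_def indicator_def)
      moreover have "eq (walk \<omega> k) = indicator {\<omega>. walk \<omega> k = inv h} \<omega>" for \<omega>
        by (simp add: eq_def indicator_def)
      moreover have "integrable \<Omega> (\<lambda>\<omega>. indicator (F R) \<omega> :: real)"
        "integrable \<Omega> (\<lambda>\<omega>. indicator {\<omega>. walk \<omega> k = inv h} \<omega> :: real)"
        by (auto simp: F_def path.P.emeasure_eq_measure)
      ultimately show ?thesis using path.P.prob_space by (simp add: w_def F_def)
    qed
    moreover have "k / N \<le> d"
    proof -
      have "k < real n3 * d" using n3 d by (simp add: field_simps)
      also have "\<dots> \<le> real N * d" using N d by (intro mult_right_mono) (auto simp: n_def)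
      finally show ?thesis using N by (simp add: field_simps)
    qed
    ultimately have "- 4 * d < w * (?p - (l + d))" using big R by argo
    also have "\<dots> \<le> w * (?p - l)" using w d by (intro mult_left_mono) auto
    finally have "w * (- (e / 2)) < w * (?p - l)" unfolding d_def by argo
    then have "- (e / 2) < ?p - l" using w by (simp only: mult_less_cancel_left_pos)
    then show ?thesis using \<open>e > 0\<close> by argo
  qed
  then show ?thesis using d by blast
qed

text \<open>If the limiting supremum \<open>l\<close> exceeded 1/3, three disjoint translates of a
  nearly extremal half-space would each have mass above 1/3. Which axis supplies them depends on the
  half-space, so six elements are controlled at once.\<close>

lemma deep_half_space_avg_le:
  assumes \<gamma>1: "contracting_geodesic C \<gamma>\<^sub>1" "g\<^sub>1 \<in> carrier G" "\<forall>t. \<phi> g\<^sub>1 (\<gamma>\<^sub>1 t) = \<gamma>\<^sub>1 (t + \<tau>\<^sub>1)" "\<tau>\<^sub>1 \<noteq> 0"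
    and \<gamma>2: "contracting_geodesic C \<gamma>\<^sub>2" "g\<^sub>2 \<in> carrier G" "\<forall>t. \<phi> g\<^sub>2 (\<gamma>\<^sub>2 t) = \<gamma>\<^sub>2 (t + \<tau>\<^sub>2)" "\<tau>\<^sub>2 \<noteq> 0"
    and diverge: "\<And>R. \<exists>M. \<forall>r\<^sub>1 r\<^sub>2. dist (\<gamma>\<^sub>1 r\<^sub>1) (\<gamma>\<^sub>2 r\<^sub>2) \<le> R \<longrightarrow> dist b (\<gamma>\<^sub>1 r\<^sub>1) \<le> M"
  obtains n where "\<And>N \<eta> s. n \<le> N \<Longrightarrow> 0 < N \<Longrightarrow> contracting_geodesic C \<eta> \<Longrightarrow>
    proj_param \<eta> b + real n \<le> s \<Longrightarrow> half_space_avg N \<eta> s \<le> 2 / 5"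
proof -
  obtain E where E: "\<And>\<eta> s. contracting_geodesic C \<eta> \<Longrightarrow> proj_param \<eta> b + E \<le> s \<Longrightarrow>
     \<exists>\<gamma>\<in>{\<gamma>\<^sub>1, \<gamma>\<^sub>2}. \<forall>x y. s \<le> proj_param \<eta> x \<longrightarrow> s \<le> proj_param \<eta> y \<longrightarrow>
       \<bar>proj_param \<gamma> x - proj_param \<gamma> y\<bar> \<le> 20 * C"
    using deep_half_space_small_projection[OF geodesic_ex \<gamma>1(1) \<gamma>2(1) diverge] by blast
  obtain h1 :: "nat \<Rightarrow> 'g" where h1: "\<And>j. h1 j \<in> carrier G" "\<And>H i j. \<forall>x\<in>H. \<forall>y\<in>H.
      \<bar>proj_param \<gamma>\<^sub>1 x - proj_param \<gamma>\<^sub>1 y\<bar> \<le> 20 * C \<Longrightarrow> i \<noteq> j \<Longrightarrow> \<phi> (h1 i) ` H \<inter> \<phi> (h1 j) ` H = {}"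
    using disjoint_translates_along_axis[OF \<gamma>1] by meson
  obtain h2 :: "nat \<Rightarrow> 'g" where h2: "\<And>j. h2 j \<in> carrier G" "\<And>H i j. \<forall>x\<in>H. \<forall>y\<in>H.
      \<bar>proj_param \<gamma>\<^sub>2 x - proj_param \<gamma>\<^sub>2 y\<bar> \<le> 20 * C \<Longrightarrow> i \<noteq> j \<Longrightarrow> \<phi> (h2 i) ` H \<inter> \<phi> (h2 j) ` H = {}"
    using disjoint_translates_along_axis[OF \<gamma>2] by meson
  define V where "V n = {half_space_avg N \<eta> s | N \<eta> s. n \<le> N \<and> 0 < N \<and> contracting_geodesic C \<eta> \<and>
    proj_param \<eta> b + real n \<le> s}" for n
  have V: "half_space_avg N \<eta> s \<in> V n" if "n \<le> N" "0 < N" "contracting_geodesic C \<eta>"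
    "proj_param \<eta> b + real n \<le> s" for N n \<eta> s
    unfolding V_def using that by blast
  obtain l where l: "0 \<le> l" "\<And>e. e > 0 \<Longrightarrow> \<exists>n. \<forall>p\<in>V n. p < l + e" "\<And>e n. e > 0 \<Longrightarrow> \<exists>p\<in>V n. l - e < p"
  proof (rule decreasing_sets_limit_of_suprema[of V])
    show "V n \<noteq> {}" for n
      using V[of n "Suc n" \<gamma>\<^sub>1 "proj_param \<gamma>\<^sub>1 b + real n"] \<gamma>1(1) by auto
    show "V n \<subseteq> {0..1}" for n
      using half_space_avg_nonneg half_space_avg_le_1 unfolding V_def by auto
    show "V n \<subseteq> V m" if "m \<le> n" for m n
    proof
      fix p assume "p \<in> V n"
      then obtain N \<eta> s where "p = half_space_avg N \<eta> s" "n \<le> N" "0 < N" "contracting_geodesic C \<eta>"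
        "proj_param \<eta> b + real n \<le> s"
        unfolding V_def by blast
      then show "p \<in> V m" using V[of m N \<eta> s] that by simp
    qed
  qed blast
  have upper: "\<exists>n. \<forall>N \<eta> s. n \<le> N \<longrightarrow> 0 < N \<longrightarrow> contracting_geodesic C \<eta> \<longrightarrow>
      proj_param \<eta> b + real n \<le> s \<longrightarrow> half_space_avg N \<eta> s < l + e" if "e > 0" for e
    using l(2)[OF that] V by meson
  have "l \<le> 1 / 3"
  proof (rule ccontr)
    assume "\<not> l \<le> 1 / 3"
    \<comment> \<open>Then \<open>l - e\<close> is 1/3, and three disjoint sets of larger mass are
      impossible.\<close>
    define e where "e = l - 1 / 3"
    have e: "e > 0" using \<open>\<not> l \<le> 1 / 3\<close> unfolding e_def by simp
    define good where "good h d n \<longleftrightarrow> (\<forall>N \<eta> s. n \<le> N \<longrightarrow> 0 < N \<longrightarrow> contracting_geodesic C \<eta> \<longrightarrow>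
      proj_param \<eta> b + real n \<le> s \<longrightarrow> l - d < half_space_avg N \<eta> s \<longrightarrow>
      l - e < half_space_avg N (\<phi> h \<circ> \<eta>) s)" for h d and n :: nat
    have good: "\<exists>d>0. \<exists>n. good h d n" if "h \<in> carrier G" for h
      unfolding good_def using half_space_avg_translate[OF that e l(1) upper] by blast
    have good_mono: "good h d' n'" if "good h d n" "d' \<le> d" "n \<le> n'" for h d d' n n'
      unfolding good_def
    proof (intro allI impI)
      fix N \<eta> s
      assume "n' \<le> N" "0 < N" "contracting_geodesic C \<eta>" "proj_param \<eta> b + real n' \<le> s"
        "l - d' < half_space_avg N \<eta> s"
      then show "l - e < half_space_avg N (\<phi> h \<circ> \<eta>) s"
        using that unfolding good_def by (meson diff_left_mono le_less_trans order_trans add_left_mono of_nat_mono)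
    qed
    have "\<exists>d>0. \<exists>n. \<forall>h\<in>F. good h d n" if "finite F" "F \<subseteq> carrier G" for F
      using that
    proof (induction F)
      case empty
      show ?case by (auto intro: exI[of _ 1])
    next
      case (insert h F)
      then obtain d n where dn: "d > 0" "\<forall>h\<in>F. good h d n" by auto
      obtain d' n' where dn': "d' > 0" "good h d' n'" using good[of h] insert.prems by blast
      show ?case
      proof (intro exI conjI ballI)
        show "min d d' > 0" using dn dn' by simp
        show "good h' (min d d') (max n n')" if "h' \<in> insert h F" for h'
        proof (cases "h' = h")
          case True
          then show ?thesis using good_mono[OF dn'(2)] by simp
        next
          case False
          then have "good h' d n" using that dn by blast
          then show ?thesis by (rule good_mono) auto
        qed
      qed
    qed
    moreover have "finite (h1 ` {..<3} \<union> h2 ` {..<3})" "h1 ` {..<3} \<union> h2 ` {..<3} \<subseteq> carrier G"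
      using h1(1) h2(1) by auto
    ultimately have "\<exists>d>0. \<exists>n. \<forall>h\<in>h1 ` {..<3} \<union> h2 ` {..<3}. good h d n" .
    then obtain d n where d: "d > 0" and dn: "\<forall>h\<in>h1 ` {..<3} \<union> h2 ` {..<3}. good h d n"
      by (elim exE conjE)
    \<comment> \<open>The depth must suffice both for the translation estimate and for small
      projection to one of the axes.\<close>
    obtain n' :: nat where n': "max (real n) E \<le> real n'" using real_arch_simple by blast
    obtain p where "p \<in> V n'" "l - d < p" using l(3)[OF d] by blast
    then obtain N \<eta> s where N: "n' \<le> N" "0 < N" and \<eta>: "contracting_geodesic C \<eta>"
      and s: "proj_param \<eta> b + real n' \<le> s" and big: "l - d < half_space_avg N \<eta> s"
      unfolding V_def by blast
    have "n \<le> N" "proj_param \<eta> b + real n \<le> s" "proj_param \<eta> b + E \<le> s" using n' N s by auto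
    then have trans: "l - e < half_space_avg N (\<phi> h \<circ> \<eta>) s" if "h \<in> h1 ` {..<3} \<union> h2 ` {..<3}" for h
      using dn[rule_format, OF that] N \<eta> big unfolding good_def by blast
    let ?H = "{x. s \<le> proj_param \<eta> x}"
    have contra: False
      if h: "\<And>j. h j \<in> carrier G" "\<And>i j. i \<noteq> j \<Longrightarrow> \<phi> (h i) ` ?H \<inter> \<phi> (h j) ` ?H = {}"
        and tr: "\<And>j. j < 3 \<Longrightarrow> l - e < half_space_avg N (\<phi> (h j) \<circ> \<eta>) s" for h :: "nat \<Rightarrow> 'g"
    proof -
      have "(\<Sum>j\<in>{..<3::nat}. half_space_avg N (\<phi> (h j) \<circ> \<eta>) s) \<le> 1"
        by (rule half_space_avg_disjoint) (use h in auto)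
      moreover have "(\<Sum>j\<in>{..<3::nat}. l - e) < (\<Sum>j\<in>{..<3::nat}. half_space_avg N (\<phi> (h j) \<circ> \<eta>) s)"
        using tr by (intro sum_strict_mono) (auto simp: lessThan_empty_iff)
      ultimately show False unfolding e_def by simp
    qed
    have "(\<forall>x\<in>?H. \<forall>y\<in>?H. \<bar>proj_param \<gamma>\<^sub>1 x - proj_param \<gamma>\<^sub>1 y\<bar> \<le> 20 * C) \<or>
      (\<forall>x\<in>?H. \<forall>y\<in>?H. \<bar>proj_param \<gamma>\<^sub>2 x - proj_param \<gamma>\<^sub>2 y\<bar> \<le> 20 * C)"
      using E[OF \<eta> \<open>proj_param \<eta> b + E \<le> s\<close>] by simp
    then show False
    proof
      assume 1: "\<forall>x\<in>?H. \<forall>y\<in>?H. \<bar>proj_param \<gamma>\<^sub>1 x - proj_param \<gamma>\<^sub>1 y\<bar> \<le> 20 * C"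
      show False by (rule contra[of h1]) (use h1(1) h1(2)[OF 1] trans in auto)
    next
      assume 2: "\<forall>x\<in>?H. \<forall>y\<in>?H. \<bar>proj_param \<gamma>\<^sub>2 x - proj_param \<gamma>\<^sub>2 y\<bar> \<le> 20 * C"
      show False by (rule contra[of h2]) (use h2(1) h2(2)[OF 2] trans in auto)
    qed
  qed
  obtain n where n: "\<forall>N \<eta> s. n \<le> N \<longrightarrow> 0 < N \<longrightarrow> contracting_geodesic C \<eta> \<longrightarrow>
      proj_param \<eta> b + real n \<le> s \<longrightarrow> half_space_avg N \<eta> s < l + 1 / 15"
    using upper[of "1 / 15"] by auto
  show thesis
  proof (rule that[of n])
    fix N \<eta> s
    assume "n \<le> N" "0 < N" "contracting_geodesic C \<eta>" "proj_param \<eta> b + real n \<le> s"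
    then have "half_space_avg N \<eta> s < l + 1 / 15" using n by blast
    then show "half_space_avg N \<eta> s \<le> 2 / 5" using \<open>l \<le> 1 / 3\<close> by argo
  qed
qed

end

section \<open>Staying beyond a gate\<close>

context isometric_random_walk
begin

text \<open>
  \<open>half_space_avg N (\<phi> (inv h) \<circ> \<eta>) s\<close> is an almost harmonic function of \<open>h\<close> which is small off
  \<open>A\<close>; optional stopping at the exit from \<open>A\<close> bounds from below the probability to stay in \<open>A\<close>.
\<close>

lemma half_space_avg_le_stay_prob:
  fixes n :: nat
  assumes "0 < N" and h: "h \<in> carrier G"
    and off: "\<And>g. g \<in> carrier G \<Longrightarrow> g \<notin> A \<Longrightarrow> half_space_avg N (\<phi> (inv g) \<circ> \<eta>) s \<le> 2 / 5"
  shows "half_space_avg N (\<phi> (inv h) \<circ> \<eta>) s \<le>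
    2 / 5 + 3 / 5 * measure \<Omega> {\<omega>. \<forall>i\<le>n. h \<otimes> walk \<omega> i \<in> A} + n / N"
  using h
proof (induction n arbitrary: h)
  \<comment> \<open>The right-hand side is at least 1 inside \<open>A\<close> and at least 2/5
    outside, the two values available without any step. Each later step adds the stationarity error
    1/N.\<close>
  case 0
  show ?case
  proof (cases "h \<in> A")
    case True
    then show ?thesis using half_space_avg_le_1[of N "\<phi> (inv h) \<circ> \<eta>" s] 0 path.P.prob_space by (simp add: comp_def)
  next
    case False
    show ?thesis by (rule order_trans[OF off[OF 0 False]]) simp
  qed
next
  case (Suc n)
  let ?q = "\<lambda>n h. measure \<Omega> {\<omega>. \<forall>i\<le>n. h \<otimes> walk \<omega> i \<in> A}"
  let ?v = "\<lambda>h. half_space_avg N (\<phi> (inv h) \<circ> \<eta>) s"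
  show ?case
  proof (cases "h \<in> A")
    case False
    then have "?v h \<le> 2 / 5" using off Suc.prems by blast
    also have "\<dots> \<le> 2 / 5 + 3 / 5 * ?q (Suc n) h + Suc n / N" by simp
    finally show ?thesis .
  next
    case True
    have inv: "\<phi> (inv (h \<otimes> w)) \<circ> \<eta> = \<phi> (inv w) \<circ> (\<phi> (inv h) \<circ> \<eta>)" if "w \<in> carrier G" for w
      using that Suc.prems by (auto simp: inv_mult_group act_mult)
    have q: "?q (Suc n) h = (\<integral>\<omega>. ?q n (h \<otimes> walk \<omega> 1) \<partial>\<Omega>)"
    proof (subst prob_split[where m = 1])
      show "{\<omega>. \<forall>i\<le>Suc n. h \<otimes> walk \<omega> i \<in> A} \<in> sets \<Omega>"
        by (rule walk_event_all[of "Suc n" "\<lambda>_ g. h \<otimes> g \<in> A"])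
      have "(\<forall>i\<le>Suc n. h \<otimes> walk (comb_seq 1 \<omega> \<omega>') i \<in> A) \<longleftrightarrow> (\<forall>i\<le>n. h \<otimes> walk \<omega> 1 \<otimes> walk \<omega>' i \<in> A)" for \<omega> \<omega>'
      proof -
        have "h \<otimes> walk (comb_seq 1 \<omega> \<omega>') (Suc i) = h \<otimes> walk \<omega> 1 \<otimes> walk \<omega>' i" for i
          using walk_comb_seq[of 1 \<omega> \<omega>' i] Suc.prems by (simp add: m_assoc del: comb_seq_Suc_0)
        then show ?thesis using True Suc.prems by (auto simp: All_less_Suc2 less_Suc_eq_le[symmetric] simp del: comb_seq_Suc_0)
      qed
      then show "(\<integral>\<omega>. measure \<Omega> {\<omega>'. \<forall>i\<le>Suc n. h \<otimes> walk (comb_seq 1 \<omega> \<omega>') i \<in> A} \<partial>\<Omega>) = (\<integral>\<omega>. ?q n (h \<otimes> walk \<omega> 1) \<partial>\<Omega>)"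
        by simp
    qed
    have "?v h \<le> real 1 / N + (\<integral>\<omega>. half_space_avg N (\<phi> (inv (walk \<omega> 1)) \<circ> (\<phi> (inv h) \<circ> \<eta>)) s \<partial>\<Omega>)"
      by (rule half_space_avg_le_shift) fact
    also have "\<dots> = 1 / N + (\<integral>\<omega>. ?v (h \<otimes> walk \<omega> 1) \<partial>\<Omega>)"
      by (simp add: inv del: One_nat_def)
    also have "(\<integral>\<omega>. ?v (h \<otimes> walk \<omega> 1) \<partial>\<Omega>) \<le> (\<integral>\<omega>. 2 / 5 + 3 / 5 * ?q n (h \<otimes> walk \<omega> 1) + n / N \<partial>\<Omega>)"
    proof (rule integral_mono)
      show "integrable \<Omega> (\<lambda>\<omega>. ?v (h \<otimes> walk \<omega> 1))"
        using half_space_avg_nonneg half_space_avg_le_1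
        by (intro integrable_fun_walk[where B = 1]) auto
      show "integrable \<Omega> (\<lambda>\<omega>. 2 / 5 + 3 / 5 * ?q n (h \<otimes> walk \<omega> 1) + n / N)"
        by (intro Bochner_Integration.integrable_add integrable_mult_right path.P.integrable_const
            integrable_fun_walk[where B = 1 and F = "\<lambda>g. ?q n (h \<otimes> g)"]) simp
      show "?v (h \<otimes> walk \<omega> 1) \<le> 2 / 5 + 3 / 5 * ?q n (h \<otimes> walk \<omega> 1) + n / N" for \<omega>
        by (rule Suc.IH) (simp add: Suc.prems)
    qed
    also have "\<dots> = 2 / 5 + 3 / 5 * (\<integral>\<omega>. ?q n (h \<otimes> walk \<omega> 1) \<partial>\<Omega>) + n / N"
    proof -
      have "integrable \<Omega> (\<lambda>\<omega>. ?q n (h \<otimes> walk \<omega> 1))"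
        by (rule integrable_fun_walk[where B = 1 and F = "\<lambda>g. ?q n (h \<otimes> g)"]) simp
      then show ?thesis using path.P.prob_space by simp
    qed
    finally show ?thesis unfolding q by (simp add: add_divide_distrib)
  qed
qed

lemma comb_seq_event:
  assumes "E \<in> sets \<Omega>" shows "{\<omega>'. comb_seq m \<omega> \<omega>' \<in> E} \<in> sets \<Omega>"
proof -
  have "(\<lambda>\<omega>'. comb_seq m \<omega> \<omega>') \<in> measurable \<Omega> \<Omega>"
    by (rule measurable_comb_seq') simp_all
  from measurable_sets[OF this assms] show ?thesis by (simp add: vimage_def)
qed

text \<open>Positivity comes in two stages: the walk reaches a deep element \<open>g\<close> with
  positive probability, and from there it stays in \<open>A\<close> forever with probability at
  least 1/3.\<close>

lemma eventually_beyond_prob: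
  assumes small: "\<And>N \<eta> s. n \<le> N \<Longrightarrow> 0 < N \<Longrightarrow> contracting_geodesic C \<eta> \<Longrightarrow>
      proj_param \<eta> b + real n \<le> s \<Longrightarrow> half_space_avg N \<eta> s \<le> 2 / 5"
    and \<eta>: "contracting_geodesic C \<eta>"
    and unbounded: "\<And>B. \<exists>g\<in>carrier G. B \<le> proj_param \<eta> (\<phi> g b)"
  shows "measure \<Omega> {\<omega>. \<forall>\<^sub>F i in sequentially. L \<le> proj_param \<eta> (\<phi> (walk \<omega> i) b)} > 0"
proof -
  have C: "C > 0" using \<eta> by (simp add: contracting_geodesic_def)
  \<comment> \<open>Seen from an element outside \<open>A\<close>, the basepoint projects below
    \<open>L\<close>, so the threshold \<open>s\<close> has depth at least \<open>n\<close>.\<close>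
  define s where "s = L + n"
  define A where "A = {g \<in> carrier G. L \<le> proj_param \<eta> (\<phi> g b)}"
  \<comment> \<open>The element \<open>g\<close> is so deep that the complementary half-space,
    described by the reversed line, is deep as well; 2C pays for two uses of
    \<open>proj_reverse\<close>.\<close>
  obtain g where g: "g \<in> carrier G" and gs: "s + n + 2 * C + 1 \<le> proj_param \<eta> (\<phi> g b)"
    using unbounded by blast
  let ?v = "\<lambda>N h. half_space_avg N (\<phi> (inv h) \<circ> \<eta>) s"
  let ?q = "\<lambda>k. measure \<Omega> {\<omega>. \<forall>i\<le>k. g \<otimes> walk \<omega> i \<in> A}"
  have off: "?v N h \<le> 2 / 5" if "h \<in> carrier G" "h \<notin> A" "n \<le> N" "0 < N" for N h
    using that \<eta> by (intro small contracting_geodesic_act) (auto simp: proj_param_act A_def s_def)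
  have vg: "?v N g \<ge> 3 / 5" if N: "n \<le> N" "0 < N" for N
  proof -
    let ?\<eta> = "\<phi> (inv g) \<circ> \<eta>" and ?\<eta>' = "reverse_line (\<phi> (inv g) \<circ> \<eta>)"
    have c: "contracting_geodesic C ?\<eta>" using \<eta> g by (simp add: contracting_geodesic_act)
    interpret contracting C ?\<eta> using c by unfold_locales
    have "proj_param ?\<eta>' b + real n \<le> - s - C"
      using proj_reverse[of b] gs g by (simp add: proj_param_act abs_le_iff)
    then have "half_space_avg N ?\<eta>' (- s - C) \<le> 2 / 5"
      using contracting_geodesic_reverse[OF c] N by (intro small)
    \<comment> \<open>The threshold \<open>- s - C\<close> lets the two opposite half-spaces cover
      the space despite the error in \<open>proj_reverse\<close>.\<close>
    moreover have "1 \<le> half_space_avg N ?\<eta> s + half_space_avg N ?\<eta>' (- s - C)"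
    proof -
      let ?p = "\<lambda>i. measure \<Omega> {\<omega>. s \<le> proj_param ?\<eta> (\<phi> (walk \<omega> i) b)}"
      let ?p' = "\<lambda>i. measure \<Omega> {\<omega>. - s - C \<le> proj_param ?\<eta>' (\<phi> (walk \<omega> i) b)}"
      have "1 \<le> ?p i + ?p' i" for i
      proof -
        let ?E = "{\<omega>. s \<le> proj_param ?\<eta> (\<phi> (walk \<omega> i) b)}" and ?E' = "{\<omega>. - s - C \<le> proj_param ?\<eta>' (\<phi> (walk \<omega> i) b)}"
        have E: "?E \<in> sets \<Omega>" "?E' \<in> sets \<Omega>" by (rule walk_event)+
        have "\<omega> \<in> ?E \<union> ?E'" for \<omega> using proj_reverse[of "\<phi> (walk \<omega> i) b"] by (auto simp: abs_le_iff)
        then have "?E \<union> ?E' = UNIV" by blast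
        then have "1 = measure \<Omega> (?E \<union> ?E')" using path.P.prob_space by simp
        also have "\<dots> \<le> ?p i + ?p' i" by (rule measure_Un_le[OF E])
        finally show ?thesis .
      qed
      then have "(\<Sum>i<N. 1) \<le> (\<Sum>i<N. ?p i + ?p' i)" by (intro sum_mono)
      then show ?thesis using N unfolding half_space_avg_def
        by (simp add: sum.distrib field_simps)
    qed
    ultimately show ?thesis by argo
  qed
  have q: "?q k \<ge> 1 / 3" for k
  proof (rule field_le_epsilon)
    fix e :: real assume e: "e > 0"
    \<comment> \<open>The staying probability does not involve \<open>N\<close>, so \<open>N\<close>
      may grow with \<open>k\<close> fixed until the error is negligible.\<close>
    obtain m :: nat where m: "2 * k / e < real m" using reals_Archimedean2 by blast
    define N where "N = n + m + 1"
    have N: "n \<le> N" "0 < N" by (auto simp: N_def)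
    have "3 / 5 \<le> 2 / 5 + 3 / 5 * ?q k + k / N"
      using half_space_avg_le_stay_prob[OF N(2) g off[OF _ _ N], of A k] vg[OF N] by linarith
    moreover have "k / N \<le> e / 2"
    proof -
      have "2 * k < real m * e" using m e by (simp add: field_simps)
      also have "\<dots> \<le> real N * e" using e by (intro mult_right_mono) (auto simp: N_def)
      finally show ?thesis using N by (simp add: field_simps)
    qed
    ultimately show "1 / 3 \<le> ?q k + e" using e by argo
  qed
  define Q where "Q = {\<omega>. \<forall>i. g \<otimes> walk \<omega> i \<in> A}"
  have "(\<lambda>k. ?q k) \<longlonglongrightarrow> measure \<Omega> (\<Inter>k. {\<omega>. \<forall>i\<le>k. g \<otimes> walk \<omega> i \<in> A})"
  proof (rule path.P.finite_Lim_measure_decseq)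
    show "range (\<lambda>k. {\<omega>. \<forall>i\<le>k. g \<otimes> walk \<omega> i \<in> A}) \<subseteq> sets \<Omega>"
      using walk_event_all[of _ "\<lambda>_ h. g \<otimes> h \<in> A"] by auto
  qed (auto simp: decseq_def)
  moreover have "(\<Inter>k. {\<omega>. \<forall>i\<le>k. g \<otimes> walk \<omega> i \<in> A}) = Q" unfolding Q_def by auto
  ultimately have Q: "measure \<Omega> Q \<ge> 1 / 3"
    using q by (intro tendsto_lowerbound[of ?q _ sequentially]) auto
  obtain k where k: "measure \<Omega> {\<omega>. walk \<omega> k = g} > 0" using prob_walk_eq_pos[OF g] by blast
  let ?E = "{\<omega>. \<forall>\<^sub>F i in sequentially. L \<le> proj_param \<eta> (\<phi> (walk \<omega> i) b)}"
  have E: "?E \<in> sets \<Omega>" by (rule walk_event_eventually)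
  have "0 < measure \<Omega> {\<omega>. walk \<omega> k = g} * measure \<Omega> Q" using k Q by (intro mult_pos_pos) auto
  also have "\<dots> = (\<integral>\<omega>. indicator {\<omega>. walk \<omega> k = g} \<omega> * measure \<Omega> Q \<partial>\<Omega>)" by simp
  also have "\<dots> \<le> (\<integral>\<omega>. measure \<Omega> {\<omega>'. comb_seq k \<omega> \<omega>' \<in> ?E} \<partial>\<Omega>)"
  proof (rule integral_mono)
    show "integrable \<Omega> (\<lambda>\<omega>. indicator {\<omega>. walk \<omega> k = g} \<omega> * measure \<Omega> Q)"
      by (intro integrable_mult_left integrable_real_indicator) (auto simp: path.P.emeasure_eq_measure)
    show "integrable \<Omega> (\<lambda>\<omega>. measure \<Omega> {\<omega>'. comb_seq k \<omega> \<omega>' \<in> ?E})"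
      using path.prob_comb_seq(2)[OF E, of k] by (intro path.P.integrable_const_bound[where B = 1]) auto
    fix \<omega>
    show "indicator {\<omega>. walk \<omega> k = g} \<omega> * measure \<Omega> Q \<le> measure \<Omega> {\<omega>'. comb_seq k \<omega> \<omega>' \<in> ?E}"
    proof (cases "walk \<omega> k = g")
      case True
      have "Q \<subseteq> {\<omega>'. comb_seq k \<omega> \<omega>' \<in> ?E}"
      proof
        fix \<omega>' assume "\<omega>' \<in> Q"
        then have "L \<le> proj_param \<eta> (\<phi> (walk (comb_seq k \<omega> \<omega>') (i + k)) b)" for i
          unfolding walk_comb_seq True Q_def A_def by auto
        then have "\<forall>\<^sub>F i in sequentially. L \<le> proj_param \<eta> (\<phi> (walk (comb_seq k \<omega> \<omega>') (i + k)) b)"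
          by simp
        then show "\<omega>' \<in> {\<omega>'. comb_seq k \<omega> \<omega>' \<in> ?E}"
          using eventually_sequentially_seg[of "\<lambda>i. L \<le> proj_param \<eta> (\<phi> (walk (comb_seq k \<omega> \<omega>') i) b)" k] by blast
      qed
      moreover have "{\<omega>'. comb_seq k \<omega> \<omega>' \<in> ?E} \<in> sets \<Omega>"
        by (rule comb_seq_event[OF E])
      ultimately show ?thesis using True path.P.finite_measure_mono by simp
    qed simp
  qed
  also have "\<dots> = measure \<Omega> ?E" using path.prob_comb_seq(1)[OF E, of k] by simp
  finally show ?thesis .
qed

text \<open>Powers of \<open>g\<close> of suitable sign move the orbit towards either end, which
  gives \<open>eventually_beyond_prob\<close> for both orientations.\<close>

lemma proj_param_orbit_unbounded:
  assumes \<gamma>: "contracting_geodesic C \<gamma>" "g \<in> carrier G" "\<forall>t. \<phi> g (\<gamma> t) = \<gamma> (t + \<tau>)" "\<tau> \<noteq> 0"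
  shows "\<exists>h\<in>carrier G. B \<le> proj_param \<gamma> (\<phi> h b)"
    and "\<exists>h\<in>carrier G. B \<le> proj_param (reverse_line \<gamma>) (\<phi> h b)"
proof -
  interpret contracting C \<gamma> using \<gamma> by unfold_locales
  have pow: "\<exists>m::int. D \<le> m * \<tau>" for D
  proof -
    obtain k :: nat where "D / \<bar>\<tau>\<bar> \<le> real k" using real_arch_simple by blast
    then have "D \<le> k * \<bar>\<tau>\<bar>" using \<open>\<tau> \<noteq> 0\<close> by (simp add: field_simps)
    then have "D \<le> (if \<tau> > 0 then int k else - int k) * \<tau>"
      using \<open>\<tau> \<noteq> 0\<close> by (auto simp: abs_if split: if_splits)
    then show ?thesis by blast
  qed
  obtain m :: int where "B - T b + C \<le> m * \<tau>" using pow by blast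
  then have "B \<le> T (\<phi> (g [^] m) b)" using proj_axis_pow[OF \<gamma>(1-3), of m b] by linarith
  then show "\<exists>h\<in>carrier G. B \<le> T (\<phi> h b)" using \<gamma>(2) by (metis int_pow_closed)
  obtain m :: int where "B + T b + 2 * C \<le> m * \<tau>" using pow by blast
  then have "B \<le> - T (\<phi> (g [^] - m) b) - C" using proj_axis_pow[OF \<gamma>(1-3), of "- m" b] by simp
  then have "B \<le> proj_param (reverse_line \<gamma>) (\<phi> (g [^] - m) b)"
    using proj_reverse[of "\<phi> (g [^] - m) b"] by linarith
  then show "\<exists>h\<in>carrier G. B \<le> proj_param (reverse_line \<gamma>) (\<phi> h b)" using \<gamma>(2) by (metis int_pow_closed)
qed

lemma AE_infinitely_many_gates:
  assumes small: "\<And>N \<eta> s. n \<le> N \<Longrightarrow> 0 < N \<Longrightarrow> contracting_geodesic C \<eta> \<Longrightarrow>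
      proj_param \<eta> b + real n \<le> s \<Longrightarrow> half_space_avg N \<eta> s \<le> 2 / 5"
    and \<gamma>: "contracting_geodesic C \<gamma>" "g \<in> carrier G" "\<forall>t. \<phi> g (\<gamma> t) = \<gamma> (t + \<tau>)" "\<tau> \<noteq> 0"
  shows "AE \<omega> in \<Omega>. \<exists>\<^sub>F m in sequentially. \<exists>\<eta>. contracting_geodesic C \<eta> \<and>
      proj_param \<eta> b \<le> proj_param \<eta> (\<phi> (walk \<omega> m) b) + 2 * C \<and> line_dist \<eta> (\<phi> (walk \<omega> m) b) \<le> line_dist \<gamma> b \<and>
      (\<forall>\<^sub>F i in sequentially. proj_param \<eta> (\<phi> (walk \<omega> m) b) + L \<le> proj_param \<eta> (\<phi> (walk \<omega> i) b))"
proof -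
  interpret contracting C \<gamma> using \<gamma> by unfold_locales
  let ?\<Gamma> = "{\<gamma>, reverse_line \<gamma>}"
  have \<Gamma>: "contracting_geodesic C \<eta>" "line_dist \<eta> b = line_dist \<gamma> b" if "\<eta> \<in> ?\<Gamma>" for \<eta>
    using that \<gamma>(1) contracting_geodesic_reverse line_dist_reverse by auto
  define beyond where "beyond \<eta> h i g \<longleftrightarrow> proj_param \<eta> b + L \<le> proj_param \<eta> (\<phi> (inv h \<otimes> g) b)"
    for \<eta> h and i :: nat and g
  \<comment> \<open>The event is written in the frame of \<open>walk \<omega> m\<close>: there the
    translated axis becomes \<eta>, the current position becomes \<open>b\<close>, and the basepoint
    becomes \<open>\<phi> (inv (walk \<omega> m)) b\<close>.\<close>
  define A where "A m = {\<omega>. \<exists>\<eta>\<in>?\<Gamma>. proj_param \<eta> (\<phi> (inv (walk \<omega> m)) b) \<le> proj_param \<eta> b + 2 * C \<and>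
      (\<forall>\<^sub>F i in sequentially. beyond \<eta> (walk \<omega> m) i (walk \<omega> i))}" for m
  define F where "F \<eta> = {\<omega>. \<forall>\<^sub>F i in sequentially. proj_param \<eta> b + L \<le> proj_param \<eta> (\<phi> (walk \<omega> i) b)}" for \<eta>
  define \<delta> where "\<delta> = min (measure \<Omega> (F \<gamma>)) (measure \<Omega> (F (reverse_line \<gamma>)))"
  have A: "A m \<in> sets \<Omega>" for m
  proof -
    \<comment> \<open>Splitting over the countably many values of \<open>walk \<omega> m\<close>
      freezes the translate, so that the tail event has measurable form.\<close>
    let ?B = "(\<Union>h\<in>carrier G. \<Union>\<eta>\<in>?\<Gamma>. {\<omega>. walk \<omega> m = h \<and> proj_param \<eta> (\<phi> (inv h) b) \<le> proj_param \<eta> b + 2 * C} \<inter>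
        {\<omega>. \<forall>\<^sub>F i in sequentially. beyond \<eta> h i (walk \<omega> i)})"
    have "A m = ?B"
    proof (intro equalityI subsetI)
      fix \<omega> assume "\<omega> \<in> A m"
      then show "\<omega> \<in> ?B" unfolding A_def by (intro UN_I[OF walk_in_carrier[of \<omega> m]]) auto
    qed (auto simp: A_def)
    moreover have "{\<omega>. \<forall>\<^sub>F i in sequentially. beyond \<eta> h i (walk \<omega> i)} \<in> sets \<Omega>" for \<eta> h
      by (rule walk_event_eventually)
    moreover have "{\<omega>. walk \<omega> m = h \<and> proj_param \<eta> (\<phi> (inv h) b) \<le> proj_param \<eta> b + 2 * C} \<in> sets \<Omega>" for \<eta> h
      by (rule walk_event)
    ultimately show ?thesis
      using countable_carrier by (auto intro!: sets.countable_UN'' sets.Int)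
  qed
  have "AE \<omega> in \<Omega>. \<exists>\<^sub>F m in sequentially. \<omega> \<in> A m"
  proof (rule path.infinitely_often_if_conditional_prob_ge[OF A])
    show "\<delta> > 0"
      unfolding \<delta>_def F_def
      using eventually_beyond_prob[OF small \<Gamma>(1)] proj_param_orbit_unbounded[OF \<gamma>] by auto
    fix m \<omega>
    let ?h = "walk \<omega> m"
    \<comment> \<open>One orientation always has the basepoint behind it. Reversal costs
      \<open>C\<close> at each of two points, hence the slack 2C; since the orientation depends on
      the past, \<delta> is a minimum over both.\<close>
    obtain \<eta> where \<eta>: "\<eta> \<in> ?\<Gamma>" "proj_param \<eta> (\<phi> (inv ?h) b) \<le> proj_param \<eta> b + 2 * C"
    proof (cases "T (\<phi> (inv ?h) b) \<le> T b")
      case True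
      then show ?thesis using that[of \<gamma>] C_pos by simp
    next
      case False
      then show ?thesis
        using that[of "reverse_line \<gamma>"] proj_reverse[of b] proj_reverse[of "\<phi> (inv ?h) b"] by auto
    qed
    have "\<delta> \<le> measure \<Omega> (F \<eta>)" using \<eta>(1) unfolding \<delta>_def by auto
    also have "\<dots> \<le> measure \<Omega> {\<omega>'. comb_seq m \<omega> \<omega>' \<in> A m}"
    proof (rule path.P.finite_measure_mono)
      show "{\<omega>'. comb_seq m \<omega> \<omega>' \<in> A m} \<in> sets \<Omega>"
        by (rule comb_seq_event[OF A])
      show "F \<eta> \<subseteq> {\<omega>'. comb_seq m \<omega> \<omega>' \<in> A m}"
      proof
        fix \<omega>' assume "\<omega>' \<in> F \<eta>"
        have "inv ?h \<otimes> walk (comb_seq m \<omega> \<omega>') (i + m) = walk \<omega>' i" for i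
          by (simp add: walk_comb_seq m_assoc[symmetric])
        then have "\<forall>\<^sub>F i in sequentially. beyond \<eta> ?h (i + m) (walk (comb_seq m \<omega> \<omega>') (i + m))"
          using \<open>\<omega>' \<in> F \<eta>\<close> unfolding F_def beyond_def by simp
        then have "\<forall>\<^sub>F i in sequentially. beyond \<eta> ?h i (walk (comb_seq m \<omega> \<omega>') i)"
          by (subst (asm) eventually_sequentially_seg)
        then show "\<omega>' \<in> {\<omega>'. comb_seq m \<omega> \<omega>' \<in> A m}"
          using \<eta> unfolding A_def by (auto simp: walk_comb_seq_le)
      qed
    qed
    finally show "\<delta> \<le> measure \<Omega> {\<omega>' \<in> space \<Omega>. comb_seq m \<omega> \<omega>' \<in> A m}" by simp
  qed
  then show ?thesis
  proof eventually_elim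
    case (elim \<omega>)
    then show ?case
    proof (rule frequently_elim1)
      fix m assume "\<omega> \<in> A m"
      let ?h = "walk \<omega> m"
      obtain \<eta> where \<eta>: "\<eta> \<in> ?\<Gamma>" "proj_param \<eta> (\<phi> (inv ?h) b) \<le> proj_param \<eta> b + 2 * C"
        "\<forall>\<^sub>F i in sequentially. beyond \<eta> ?h i (walk \<omega> i)"
        using \<open>\<omega> \<in> A m\<close> unfolding A_def by blast
      interpret h: isometry "\<phi> ?h" by (rule act_isometry) simp
      let ?\<eta> = "\<phi> ?h \<circ> \<eta>"
      have p: "proj_param ?\<eta> (\<phi> g b) = proj_param \<eta> (\<phi> (inv ?h \<otimes> g) b)" if "g \<in> carrier G" for g
        using h.proj_param_comp[of \<eta> "\<phi> (inv ?h \<otimes> g) b"] that by (simp add: act_mult)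
      have "contracting_geodesic C ?\<eta>" using \<Gamma>(1)[OF \<eta>(1)] by (rule h.contracting_geodesic_comp)
      moreover have "proj_param ?\<eta> b \<le> proj_param ?\<eta> (\<phi> ?h b) + 2 * C"
        using p[of \<one>] \<eta>(2) by (simp add: h.proj_param_comp)
      moreover have "line_dist ?\<eta> (\<phi> ?h b) \<le> line_dist \<gamma> b"
        using \<Gamma>(2)[OF \<eta>(1)] by (simp add: h.line_dist_comp)
      moreover have "\<forall>\<^sub>F i in sequentially. proj_param ?\<eta> (\<phi> ?h b) + L \<le> proj_param ?\<eta> (\<phi> (walk \<omega> i) b)"
        using \<eta>(3) by eventually_elim (simp add: beyond_def h.proj_param_comp p)
      ultimately show "\<exists>\<eta>. contracting_geodesic C \<eta> \<and>
        proj_param \<eta> b \<le> proj_param \<eta> (\<phi> ?h b) + 2 * C \<and> line_dist \<eta> (\<phi> ?h b) \<le> line_dist \<gamma> b \<and>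
        (\<forall>\<^sub>F i in sequentially. proj_param \<eta> (\<phi> ?h b) + L \<le> proj_param \<eta> (\<phi> (walk \<omega> i) b))"
        by blast
    qed
  qed
qed

text \<open>
  Properness of \<open>(m, n) \<mapsto> d(g\<^sub>1\<^sup>m b, g\<^sub>2\<^sup>n b)\<close> makes its sublevel sets finite, and the orbits
  of \<open>b\<close> are coarsely dense in the axes.
\<close>

lemma independent_axes_diverge:
  assumes indep: "independent_elements G \<phi> b g\<^sub>1 g\<^sub>2"
    and g1: "geodesic_line \<gamma>\<^sub>1" "g\<^sub>1 \<in> carrier G" "\<forall>t. \<phi> g\<^sub>1 (\<gamma>\<^sub>1 t) = \<gamma>\<^sub>1 (t + \<tau>\<^sub>1)" "\<tau>\<^sub>1 \<noteq> 0"
    and g2: "geodesic_line \<gamma>\<^sub>2" "g\<^sub>2 \<in> carrier G" "\<forall>t. \<phi> g\<^sub>2 (\<gamma>\<^sub>2 t) = \<gamma>\<^sub>2 (t + \<tau>\<^sub>2)" "\<tau>\<^sub>2 \<noteq> 0"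
  shows "\<exists>M. \<forall>r\<^sub>1 r\<^sub>2. dist (\<gamma>\<^sub>1 r\<^sub>1) (\<gamma>\<^sub>2 r\<^sub>2) \<le> R \<longrightarrow> dist b (\<gamma>\<^sub>1 r\<^sub>1) \<le> M"
proof -
  have near: "\<exists>m::int. dist (\<phi> (g [^] m) b) (\<gamma> r) \<le> dist b (\<gamma> 0) + \<bar>\<tau>\<bar>"
    if g: "geodesic_line \<gamma>" "g \<in> carrier G" "\<forall>t. \<phi> g (\<gamma> t) = \<gamma> (t + \<tau>)" "\<tau> \<noteq> 0" for \<gamma> g \<tau> r
  proof -
    \<comment> \<open>Rounding the parameter to a multiple of the translation length costs at most
      \<bar>\<tau>\<bar>.\<close>
    define m where "m = \<lfloor>r / \<tau>\<rfloor>"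
    have "\<bar>r / \<tau> - m\<bar> \<le> 1" unfolding m_def by linarith
    then have "\<bar>r / \<tau> - m\<bar> * \<bar>\<tau>\<bar> \<le> 1 * \<bar>\<tau>\<bar>" by (intro mult_right_mono) auto
    also have "\<bar>r / \<tau> - m\<bar> * \<bar>\<tau>\<bar> = \<bar>m * \<tau> - r\<bar>"
      using \<open>\<tau> \<noteq> 0\<close> by (simp add: abs_mult[symmetric] left_diff_distrib abs_minus_commute)
    finally have "dist (\<gamma> (m * \<tau>)) (\<gamma> r) \<le> \<bar>\<tau>\<bar>" by (simp add: geodesic_line_dist[OF g(1)])
    moreover have "dist (\<phi> (g [^] m) b) (\<gamma> (m * \<tau>)) = dist b (\<gamma> 0)"
      using axis_int_pow[OF g(2,3), of m 0] isometric[of "g [^] m" b "\<gamma> 0"] g(2) by simp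
    ultimately show ?thesis
      using dist_triangle[of "\<phi> (g [^] m) b" "\<gamma> r" "\<gamma> (m * \<tau>)"] by (intro exI[of _ m]) linarith
  qed
  define K where "K = dist b (\<gamma>\<^sub>1 0) + \<bar>\<tau>\<^sub>1\<bar>"
  define K' where "K' = dist b (\<gamma>\<^sub>2 0) + \<bar>\<tau>\<^sub>2\<bar>"
  define P where "P = {(m, n). dist (\<phi> (g\<^sub>1 [^] (m::int)) b) (\<phi> (g\<^sub>2 [^] (n::int)) b) \<le> R + K + K'}"
  have "compactin (discrete_topology UNIV) {x \<in> topspace (discrete_topology (UNIV :: (int \<times> int) set)).
      (\<lambda>(m, n). dist (\<phi> (g\<^sub>1 [^] m) b) (\<phi> (g\<^sub>2 [^] n) b)) x \<in> {0..R + K + K'}}"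
    by (rule compactin_proper_map_preimage[OF indep[unfolded independent_elements_def]])
       (auto simp: compactin_subtopology)
  then have "finite P" unfolding compactin_discrete_topology P_def by (simp add: case_prod_unfold)
  \<comment> \<open>Inserting 0 keeps \<open>Max\<close> defined when \<open>P\<close> is
    empty.\<close>
  define M where "M = Max (insert 0 ((\<lambda>(m, n). dist b (\<phi> (g\<^sub>1 [^] m) b)) ` P)) + K"
  have "dist b (\<gamma>\<^sub>1 r\<^sub>1) \<le> M" if "dist (\<gamma>\<^sub>1 r\<^sub>1) (\<gamma>\<^sub>2 r\<^sub>2) \<le> R" for r\<^sub>1 r\<^sub>2
  proof -
    obtain m :: int where m: "dist (\<phi> (g\<^sub>1 [^] m) b) (\<gamma>\<^sub>1 r\<^sub>1) \<le> K" using near[OF g1] unfolding K_def by blast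
    obtain n :: int where n: "dist (\<phi> (g\<^sub>2 [^] n) b) (\<gamma>\<^sub>2 r\<^sub>2) \<le> K'" using near[OF g2] unfolding K'_def by blast
    have "dist (\<phi> (g\<^sub>1 [^] m) b) (\<phi> (g\<^sub>2 [^] n) b) \<le> R + K + K'"
      using m n that dist_triangle[of "\<phi> (g\<^sub>1 [^] m) b" "\<phi> (g\<^sub>2 [^] n) b" "\<gamma>\<^sub>1 r\<^sub>1"]
        dist_triangle2[of "\<gamma>\<^sub>1 r\<^sub>1" "\<phi> (g\<^sub>2 [^] n) b" "\<gamma>\<^sub>2 r\<^sub>2"] by linarith
    then have "(m, n) \<in> P" by (simp add: P_def)
    then have "dist b (\<phi> (g\<^sub>1 [^] m) b) \<le> Max (insert 0 ((\<lambda>(m, n). dist b (\<phi> (g\<^sub>1 [^] m) b)) ` P))"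
      using \<open>finite P\<close> by (intro Max_ge) force+
    then show ?thesis unfolding M_def using m dist_triangle[of b "\<gamma>\<^sub>1 r\<^sub>1" "\<phi> (g\<^sub>1 [^] m) b"] by linarith
  qed
  then show ?thesis by blast
qed

lemma AE_increments_in_carrier: "AE \<omega> in \<Omega>. \<forall>i. \<omega> i \<in> carrier G"
  unfolding AE_all_countable
proof
  fix i
  have "AE x in measure_pmf \<mu>. x \<in> carrier G" using support by (auto simp: AE_measure_pmf_iff)
  then show "AE \<omega> in \<Omega>. \<omega> i \<in> carrier G"
    by (intro AE_PiM_component) (auto simp: measure_pmf.prob_space_axioms)
qed

end

theorem mainTheorem1:
  fixes G :: "('g, 'm) monoid_scheme"
    and \<mu> :: "'g pmf"
    and \<phi> :: "'g \<Rightarrow> 'x::complete_space \<Rightarrow> 'x"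
    and b :: 'x
  assumes "group G" and "countable (carrier G)"
    and "set_pmf \<mu> \<subseteq> carrier G" and "admissible G \<mu>"
    and "separable_space (euclidean :: 'x topology)"
    and "CAT0_space TYPE('x)"
    and "group_action G UNIV \<phi>"
    and "\<And>g x y. g \<in> carrier G \<Longrightarrow> dist (\<phi> g x) (\<phi> g y) = dist x y"
    and "\<exists>g\<^sub>1\<in>carrier G. \<exists>g\<^sub>2\<in>carrier G.
           contracting_isometry (\<phi> g\<^sub>1) \<and> contracting_isometry (\<phi> g\<^sub>2) \<and>
           independent_elements G \<phi> b g\<^sub>1 g\<^sub>2"
  shows "AE \<omega> in path_measure \<mu>. \<exists>\<xi>\<in>visual_boundary.
           limitin (cone_topology b) (\<lambda>n. Interior (\<phi> (random_walk G \<omega> n) b)) (Ideal \<xi>)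
             sequentially"
proof -
  interpret isometric_random_walk G \<mu> \<phi> b
    unfolding isometric_random_walk_def isometric_random_walk_axioms_def
    using assms(1-4,7,8) CAT0_geodesic_exists[OF assms(6)] by blast
  obtain g\<^sub>1 g\<^sub>2 where g: "g\<^sub>1 \<in> carrier G" "g\<^sub>2 \<in> carrier G"
    and contr: "contracting_isometry (\<phi> g\<^sub>1)" "contracting_isometry (\<phi> g\<^sub>2)"
    and indep: "independent_elements G \<phi> b g\<^sub>1 g\<^sub>2"
    using assms(9) by blast
  have axis: "\<exists>\<gamma> C \<tau>. contracting_geodesic C \<gamma> \<and> (\<forall>t. f (\<gamma> t) = \<gamma> (t + \<tau>)) \<and> \<tau> \<noteq> 0"
    if "contracting_isometry f" for f :: "'x \<Rightarrow> 'x"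
    using that unfolding contracting_isometry_def is_axis_def contracting_geodesic_def by blast
  obtain \<gamma>\<^sub>1 C\<^sub>1 \<tau>\<^sub>1 where 1: "contracting_geodesic C\<^sub>1 \<gamma>\<^sub>1" "\<forall>t. \<phi> g\<^sub>1 (\<gamma>\<^sub>1 t) = \<gamma>\<^sub>1 (t + \<tau>\<^sub>1)" "\<tau>\<^sub>1 \<noteq> 0"
    using axis[OF contr(1)] by blast
  obtain \<gamma>\<^sub>2 C\<^sub>2 \<tau>\<^sub>2 where 2: "contracting_geodesic C\<^sub>2 \<gamma>\<^sub>2" "\<forall>t. \<phi> g\<^sub>2 (\<gamma>\<^sub>2 t) = \<gamma>\<^sub>2 (t + \<tau>\<^sub>2)" "\<tau>\<^sub>2 \<noteq> 0"
    using axis[OF contr(2)] by blast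
  \<comment> \<open>A common constant puts both axes, with all their translates and reversals, into
    a single class of lines.\<close>
  define C where "C = max C\<^sub>1 C\<^sub>2"
  have C1: "contracting_geodesic C \<gamma>\<^sub>1" and C2: "contracting_geodesic C \<gamma>\<^sub>2"
    unfolding C_def using contracting_geodesic_mono 1(1) 2(1) by (metis max.cobounded1 max.cobounded2)+
  have lines: "geodesic_line \<gamma>\<^sub>1" "geodesic_line \<gamma>\<^sub>2" using C1 C2 by (auto simp: contracting_geodesic_def)
  obtain n where small: "\<And>N \<eta> s. n \<le> N \<Longrightarrow> 0 < N \<Longrightarrow> contracting_geodesic C \<eta> \<Longrightarrow>
      proj_param \<eta> b + real n \<le> s \<Longrightarrow> half_space_avg N \<eta> s \<le> 2 / 5"
    using deep_half_space_avg_le[OF C1 g(1) 1(2,3) C2 g(2) 2(2,3)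
        independent_axes_diverge[OF indep lines(1) g(1) 1(2,3) lines(2) g(2) 2(2,3)]]
    by (metis (no_types, lifting))
  have "AE \<omega> in \<Omega>. \<exists>\<^sub>F m in sequentially. \<exists>\<eta>. contracting_geodesic C \<eta> \<and>
      proj_param \<eta> b \<le> proj_param \<eta> (\<phi> (walk \<omega> m) b) + 2 * C \<and> line_dist \<eta> (\<phi> (walk \<omega> m) b) \<le> line_dist \<gamma>\<^sub>1 b \<and>
      (\<forall>\<^sub>F i in sequentially. proj_param \<eta> (\<phi> (walk \<omega> m) b) + (22 * C + line_dist \<gamma>\<^sub>1 b + 1) \<le>
        proj_param \<eta> (\<phi> (walk \<omega> i) b))"
    by (rule AE_infinitely_many_gates[OF small C1 g(1) 1(2,3)])
  \<comment> \<open>Almost surely all increments lie in the carrier, where the truncated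
    \<open>walk\<close> agrees with \<open>random_walk\<close>.\<close>
  with AE_increments_in_carrier show ?thesis
    unfolding path_measure_def
  proof eventually_elim
    case (elim \<omega>)
    have "\<exists>\<xi>\<in>visual_boundary. limitin (cone_topology b) (\<lambda>n. Interior (\<phi> (walk \<omega> n) b)) (Ideal \<xi>) sequentially"
      by (rule infinitely_many_gates_imp_convergence[OF assms(6)])
        (use elim(2) in \<open>simp only: add.assoc\<close>)
    then show ?case using walk_eq_random_walk[OF elim(1)] by simp
  qed
qed

end
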